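(* Let $F(z)$ be an entire function on $\mathbb{C}^m$ satisfying $|F(z)|\le Ce^{b\|z\|}$ for some constants $C,b$, and suppose that $F(x)$, $x\in\mathbb{R}^m$, is an almost periodic function by Stepanoff (of some order $p\ge1$) on $\mathbb{R}^m$ with Fourier series $\sum_{n=0}^\infty a_ne^{i\langle x,\lambda_n\rangle}$. Then $F$ is almost periodic by Bohr on every tube domain $T_D\subset\mathbb{C}^m$ with bounded base $D$, $F$ has Dirichlet series $\sum_{n=0}^\infty a_ne^{i\langle z,\lambda_n\rangle}$, and $\operatorname{sp}F\subset\{\lambda\in\mathbb{R}^m:\|\lambda\|\le b\}$.
   Context: For $K\subset\mathbb{R}^m$, $T_K=\{x+iy:x\in\mathbb{R}^m,y\in K\}$. A continuous $g$ on $T_K$ is almost periodic by Bohr if for every $\varepsilon>0$ there is $l>0$ such that every $m$-dimensional cube of side $l$ in $\mathbb{R}^m$ contains $\tau$ with $\sup_{z\in T_K}|g(z+\tau)-g(z)|<\varepsilon$. A locally integrable $f$ on $\mathbb{R}^m$ is almost periodic by Stepanoff of order $p$ if for every $\varepsilon>0$ there is $l$ such that every cube of side $l$ contains $\tau$ with $\sup_{x\in\mathbb{R}^m}\big(\int_{[0,1]^m}|f(x+u+\tau)-f(x+u)|^pdu\big)^{1/p}<\varepsilon$. Fourier coefficients: $a(\lambda)=\lim_{N\to\infty}(2N)^{-m}\int_{[-N,N]^m}f(x+x')e^{-i\langle x+x',\lambda\rangle}dx$ (uniform in and independent of $x'$); the spectrum $\operatorname{sp}$ is the set of $\lambda$ with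 $a(\lambda)\ne0$, enumerated as $\lambda_n$, $a_n=a(\lambda_n)$. *)

theory Defs
  imports "HOL-Analysis.Analysis"
begin

definition cvec :: "real^'m \<Rightarrow> complex^'m" where
  "cvec x = (\<chi> i. complex_of_real (x $ i))"

definition imv :: "complex^'m \<Rightarrow> real^'m" where
  "imv z = (\<chi> i. Im (z $ i))"

definition cpair :: "complex^'m \<Rightarrow> real^'m \<Rightarrow> complex" where
  "cpair z lam = (\<Sum>i\<in>UNIV. z $ i * complex_of_real (lam $ i))"

definition tube :: "(real^'m) set \<Rightarrow> (complex^'m) set" where
  "tube K = {z. imv z \<in> K}"

definition entire_m :: "(complex^'m \<Rightarrow> complex) \<Rightarrow> bool" where
  "entire_m F \<longleftrightarrow> (\<forall>z. \<exists>L. (F has_derivative L) (at z) \<and>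
                         (\<forall>c v. L (c *s v) = c * L v))"

definition cube :: "real^'m \<Rightarrow> real \<Rightarrow> (real^'m) set" where
  "cube a l = cbox a (a + l *\<^sub>R One)"

definition bohr_ap_on :: "(real^'m) set \<Rightarrow> (complex^'m \<Rightarrow> complex) \<Rightarrow> bool" where
  "bohr_ap_on K g \<longleftrightarrow> continuous_on (tube K) g \<and>
     (\<forall>\<epsilon>>0. \<exists>l>0. \<forall>a. \<exists>\<tau>\<in>cube a l.
        (\<exists>M<\<epsilon>. \<forall>z\<in>tube K. norm (g (z + cvec \<tau>) - g z) \<le> M))"

definition stepanoff_ap :: "real \<Rightarrow> (real^'m \<Rightarrow> complex) \<Rightarrow> bool" where
  "stepanoff_ap p f \<longleftrightarrow>
     (\<forall>a b. f absolutely_integrable_on cbox a b \<and>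
            (\<lambda>x. norm (f x) powr p) integrable_on cbox a b) \<and>
     (\<forall>\<epsilon>>0. \<exists>l>0. \<forall>a. \<exists>\<tau>\<in>cube a l.
        (\<exists>M<\<epsilon>. \<forall>x. (integral (cbox 0 One)
              (\<lambda>u. norm (f (x + u + \<tau>) - f (x + u)) powr p)) powr (1 / p) \<le> M))"

text \<open>Fourier coefficient a(lambda) (taken with x' = 0).\<close>
definition fourier_coeff :: "(real^'m \<Rightarrow> complex) \<Rightarrow> real^'m \<Rightarrow> complex" where
  "fourier_coeff f lam =
     Lim at_top (\<lambda>N::real. integral (cbox (- (N *\<^sub>R One)) (N *\<^sub>R One))
          (\<lambda>x. f x * cis (- (x \<bullet> lam))) / complex_of_real ((2 * N) ^ CARD('m)))"

definition spectrum_ap :: "(real^'m \<Rightarrow> complex) \<Rightarrow> (real^'m) set" where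
  "spectrum_ap f = {lam. fourier_coeff f lam \<noteq> 0}"

end

theory Submission
  imports Defs "HOL-Complex_Analysis.Complex_Analysis" "HOL-Real_Asymp.Real_Asymp"
begin

text \<open>
  Functions of exponential type obey a Plancherel-Polya inequality: their supremum over a tube with
  bounded base is at most a constant times the supremum of their \<open>L\<^sup>1\<close> means over real unit cubes.
  A Phragmen-Lindelof argument on complex lines carries a bound from the real subspace to the tube.
  It also yields a Lipschitz bound on the real subspace, by which the real supremum is absorbed into
  the local means. Applied to \<open>F(z + \<tau>) - F(z)\<close>, whose exponential type is that of \<open>F\<close>,
  the inequality turns Stepanoff almost periods into Bohr almost periods on tubes.

  For \<open>G(z) = F(z) exp(-i \<langle>z, \<lambda>\<rangle>)\<close> the mean over the real cube of side \<open>2N\<close>, as a function of a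
  complex shift, has derivative \<open>O(1/N)\<close>, so the mean value of \<open>G(x + iy)\<close> does not depend on \<open>y\<close>.
  This gives the coefficient formula. Comparing it with the growth \<open>exp(b |y|)\<close> of \<open>F(x + iy)\<close> as
  \<open>y\<close> runs to infinity against \<open>\<lambda>\<close> bounds the spectrum.
\<close>

subsection \<open>A Phragmen-Lindelof bound for functions of exponential type\<close>

text \<open>\<open>fourier_coeff\<close> is a \<open>Lim\<close>, determined only where a limit
  exists, so convergence of the means must be proved at every frequency before an identity between
  coefficients can be derived. What drives it is a compactness property: up to a uniform error,
  every translate of the modulated function is a translate by a vector from a bounded set. Two
  circularities have to be broken. Absorbing a supremum presupposes that it is finite, while the
  Stepanoff condition controls only local means; averages over small cubes are bounded for free and
  inherit the same local mean bound. And exponential type is exactly the critical growth for a half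
  plane, which leaves no room for a barrier function there; quadrants first yield some bound, and a
  bounded function then obeys the sharp one. The constant \<open>b\<close> may be negative. Then
  \<open>cball 0 b\<close> is empty and the spectrum has to be empty, so the growth in terms of
  \<open>b\<close> itself, and not only of \<open>max b 0\<close>, must survive to the last
  step.\<close>

lemma maximum_modulus_compact:
  fixes f :: "complex \<Rightarrow> complex"
  assumes "compact S" "open U" "U \<subseteq> S" "f holomorphic_on S"
    and bound: "\<And>z. z \<in> S - U \<Longrightarrow> norm (f z) \<le> B"
    and "z \<in> S"
  shows "norm (f z) \<le> B"
proof (rule maximum_modulus_frontier[where S = S and f = f])
  show "f holomorphic_on interior S"
    using assms(4) holomorphic_on_subset interior_subset by blast
  show "continuous_on (closure S) f"
    using assms by (simp add: compact_imp_closed holomorphic_on_imp_continuous_on)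
  show "bounded S" using assms compact_imp_bounded by blast
  \<comment> \<open>Since \<open>U\<close> is open and inside \<open>S\<close>, it misses the
    frontier. Bounds on \<open>S - U\<close> thus suffice, and the frontiers of truncated sectors
    and half discs never have to be computed.\<close>
  have "frontier S \<subseteq> S - U"
    using interior_maximal[OF assms(3,2)] compact_imp_closed[OF assms(1)]
    by (auto simp: frontier_def closure_closed)
  then show "norm (f w) \<le> B" if "w \<in> frontier S" for w
    using bound that by blast
qed (use assms in auto)

text \<open>Barrier for a sector of opening pi/2: the exponent 3/2 exceeds the order 1 of the
  functions to be damped and stays below 2, so the real part of the power remains positive up to the
  edges. The shift by 1 keeps the root off its branch cut, including at the vertex.\<close>

lemma Re_csqrt_cube_ge:
  assumes "\<bar>Im s\<bar> \<le> Re s"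
  shows "norm s * sqrt (norm s) / 32 \<le> Re (csqrt (1 + s) ^ 3)"
proof -
  define q where "q = csqrt (1 + s)"
  define a c where "a = Re q" and "c = Im q"
  have q2: "q ^ 2 = 1 + s" by (simp add: q_def)
  have "Re (q ^ 2) = a ^ 2 - c ^ 2" "Im (q ^ 2) = 2 * a * c"
    by (auto simp: a_def c_def power2_eq_square)
  then have "\<bar>2 * a * c\<bar> \<le> a ^ 2 - c ^ 2" using assms q2 by auto
  have a0: "a \<ge> 0"
    using Re_csqrt[of "1 + s"] by (simp add: a_def q_def)
  \<comment> \<open>The argument of \<open>q\<close> is at most pi/8, and tan(pi/8) < 1/2. This
    slope gives \<open>Re (q ^ 3) \<ge> a ^ 3 / 4\<close> and \<open>norm q \<le> 2 * a\<close>,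
    whence the constant 32 = 4 * 8.\<close>
  have ca: "\<bar>c\<bar> \<le> a / 2"
  proof (rule ccontr)
    assume "\<not> \<bar>c\<bar> \<le> a / 2"
    then have *: "a < 2 * \<bar>c\<bar>" by simp
    have "a * a \<le> a * (2 * \<bar>c\<bar>)" using a0 * by (intro mult_left_mono) auto
    also have "\<dots> = \<bar>2 * a * c\<bar>" using a0 by (simp add: abs_mult)
    also have "\<dots> \<le> a ^ 2 - c ^ 2" by fact
    finally have "c ^ 2 \<le> 0" by (simp add: power2_eq_square)
    then show False using * a0 by simp
  qed
  have c2: "c ^ 2 \<le> a ^ 2 / 4"
    using power_mono[OF ca, of 2] by (simp add: power_divide)
  have nq: "norm q \<le> 2 * a"
    using cmod_le[of q] ca a0 by (simp add: a_def c_def)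
  have "Re (q ^ 3) = a * (a ^ 2 - 3 * c ^ 2)"
    by (simp add: a_def c_def power3_eq_cube power2_eq_square algebra_simps)
  moreover have "a * (a ^ 2 / 4) \<le> a * (a ^ 2 - 3 * c ^ 2)"
    using c2 a0 by (intro mult_left_mono) auto
  ultimately have 1: "a ^ 3 / 4 \<le> Re (q ^ 3)" by (simp add: power3_eq_cube power2_eq_square)
  have 2: "norm q ^ 3 \<le> 8 * a ^ 3"
    using power_mono[OF nq, of 3] by (simp add: power_mult_distrib)
  have nq2: "norm q ^ 2 = norm (1 + s)" using q2 by (metis norm_power)
  have n1: "norm s \<le> norm (1 + s)"
  proof -
    have "(Re s)\<^sup>2 + (Im s)\<^sup>2 \<le> (1 + Re s)\<^sup>2 + (Im s)\<^sup>2"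
      using assms by (intro add_right_mono power_mono) auto
    then show ?thesis by (simp add: cmod_def)
  qed
  have "sqrt (norm s) \<le> norm q"
    using n1 nq2 by (metis norm_ge_zero real_le_lsqrt)
  then have "norm s * sqrt (norm s) \<le> norm q ^ 2 * norm q"
    using n1 nq2 by (intro mult_mono) auto
  then show ?thesis using 1 2 unfolding q_def by (simp add: power3_eq_cube power2_eq_square)
qed

text \<open>Multiplying by the exponential of minus \<epsilon> times the barrier does not increase
  the modulus on the two rays and beats the exponential growth on a large arc. The maximum principle
  bounds the product, and \<epsilon> tends to 0 at the fixed point \<open>s\<close>.\<close>

lemma phragmen_lindelof_sector:
  fixes f :: "complex \<Rightarrow> complex"
  assumes hol: "f holomorphic_on UNIV"
    and growth: "\<And>s. norm (f s) \<le> A * exp (\<sigma> * norm s)"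
    and bdry: "\<And>s. \<bar>Im s\<bar> = Re s \<Longrightarrow> norm (f s) \<le> B" and B: "B > 0"
    and s: "\<bar>Im s\<bar> \<le> Re s"
  shows "norm (f s) \<le> B"
proof -
  have *: "norm (f s) * exp (- \<epsilon> * Re (csqrt (1 + s) ^ 3)) \<le> B" if "\<epsilon> > 0" for \<epsilon>
  proof -
    define g where "g = (\<lambda>z. f z * exp (- of_real \<epsilon> * csqrt (1 + z) ^ 3))"
    have normg: "norm (g z) = norm (f z) * exp (- \<epsilon> * Re (csqrt (1 + z) ^ 3))" for z
      by (simp add: g_def norm_mult)
    have "((\<lambda>R. A * exp (\<sigma> * R - \<epsilon> * (R * sqrt R / 32))) \<longlongrightarrow> 0) at_top"
      using that by real_asymp
    then have "eventually (\<lambda>R. A * exp (\<sigma> * R - \<epsilon> * (R * sqrt R / 32)) < B) at_top"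
      using B by (rule order_tendstoD)
    then have "eventually (\<lambda>R. A * exp (\<sigma> * R - \<epsilon> * (R * sqrt R / 32)) < B \<and> R > norm s) at_top"
      by (intro eventually_conj eventually_gt_at_top)
    then obtain R where R: "A * exp (\<sigma> * R - \<epsilon> * (R * sqrt R / 32)) < B" "R > norm s"
      using eventually_happens'[OF trivial_limit_at_top_linorder] by blast
    define S where "S = {z. \<bar>Im z\<bar> \<le> Re z} \<inter> cball 0 R"
    define U where "U = {z. \<bar>Im z\<bar> < Re z} \<inter> ball 0 R"
    have "closed {z. \<bar>Im z\<bar> \<le> Re z}"
      by (intro closed_Collect_le continuous_intros)
    then have "compact S" unfolding S_def by (intro closed_Int_compact) auto
    moreover have "open U" unfolding U_def by (intro open_Int open_Collect_less continuous_intros) auto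
    moreover have "U \<subseteq> S" by (auto simp: U_def S_def)
    moreover have "g holomorphic_on S"
    proof -
      have "1 + z \<notin> \<real>\<^sub>\<le>\<^sub>0" if "z \<in> S" for z
        using that by (auto simp: S_def complex_nonpos_Reals_iff)
      then show ?thesis unfolding g_def
        by (intro holomorphic_intros holomorphic_on_subset[OF hol]) auto
    qed
    moreover have "norm (g z) \<le> B" if z: "z \<in> S - U" for z
    proof (cases "\<bar>Im z\<bar> = Re z")
      case True
      have "0 \<le> norm z * sqrt (norm z) / 32" by simp
      also have "\<dots> \<le> Re (csqrt (1 + z) ^ 3)" using Re_csqrt_cube_ge[of z] True by simp
      finally have "0 \<le> Re (csqrt (1 + z) ^ 3)" .
      then have "norm (g z) \<le> norm (f z) * 1"
        unfolding normg using \<open>\<epsilon> > 0\<close> by (intro mult_left_mono) auto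
      then show ?thesis using bdry[OF True] by simp
    next
      case False
      then have z': "\<bar>Im z\<bar> \<le> Re z" "norm z = R" using z by (auto simp: S_def U_def)
      have "0 \<le> A * exp (\<sigma> * norm z)" by (rule order_trans[OF norm_ge_zero growth])
      then have "norm (g z) \<le> A * exp (\<sigma> * norm z) * exp (- \<epsilon> * (norm z * sqrt (norm z) / 32))"
        unfolding normg using Re_csqrt_cube_ge[OF z'(1)] \<open>\<epsilon> > 0\<close> growth[of z]
        by (intro mult_mono) auto
      also have "\<dots> = A * exp (\<sigma> * R - \<epsilon> * (R * sqrt R / 32))"
        unfolding z' by (simp add: mult.assoc exp_add[symmetric])
      finally show ?thesis using R by simp
    qed
    moreover have "s \<in> S" using s R by (auto simp: S_def)
    ultimately have "norm (g s) \<le> B" by (rule maximum_modulus_compact)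
    then show ?thesis by (simp add: normg)
  qed
  have "((\<lambda>\<epsilon>. norm (f s) * exp (- \<epsilon> * Re (csqrt (1 + s) ^ 3))) \<longlongrightarrow>
          norm (f s) * exp (- 0 * Re (csqrt (1 + s) ^ 3))) (at_right 0)"
    by (intro tendsto_intros)
  then have "((\<lambda>\<epsilon>. norm (f s) * exp (- \<epsilon> * Re (csqrt (1 + s) ^ 3))) \<longlongrightarrow> norm (f s)) (at_right 0)"
    by simp
  then show ?thesis
    by (rule tendsto_upperbound) (use * in \<open>auto simp: eventually_at_right_less eventually_at_filter\<close>)
qed

text \<open>For a bounded function a linear divisor is enough:
  \<open>1 - \<i> * of_real \<delta> * z\<close> has modulus at least 1 on the closed half plane and
  grows like \<open>\<delta> * norm z\<close>. It forces the quotient below \<open>M\<close> on a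
  large arc, however big \<open>B\<close> is.\<close>

lemma phragmen_lindelof_upper_half_plane_bounded:
  fixes f :: "complex \<Rightarrow> complex"
  assumes hol: "f holomorphic_on UNIV"
    and bnd: "\<And>z. Im z \<ge> 0 \<Longrightarrow> norm (f z) \<le> B"
    and real: "\<And>x::real. norm (f (of_real x)) \<le> M" and M: "M > 0"
    and z0: "Im z0 \<ge> 0"
  shows "norm (f z0) \<le> M"
proof -
  have *: "norm (f z0) / norm (1 - \<i> * of_real \<delta> * z0) \<le> M" if d: "\<delta> > 0" for \<delta>
  proof -
    define g where "g = (\<lambda>z. f z / (1 - \<i> * of_real \<delta> * z))"
    have n1: "norm (1 - \<i> * of_real \<delta> * z) \<ge> 1" and nz: "norm (1 - \<i> * of_real \<delta> * z) \<ge> \<delta> * norm z"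
      if "Im z \<ge> 0" for z
    proof -
      have e: "1 - \<i> * of_real \<delta> * z = Complex (1 + \<delta> * Im z) (- \<delta> * Re z)"
        by (simp add: complex_eq_iff)
      have pos: "0 \<le> \<delta> * Im z" using that d by simp
      show "norm (1 - \<i> * of_real \<delta> * z) \<ge> 1"
        using complex_Re_le_cmod[of "1 - \<i> * of_real \<delta> * z"] pos by simp
      have "(\<delta> * norm z)\<^sup>2 = (\<delta> * Re z)\<^sup>2 + (\<delta> * Im z)\<^sup>2"
        by (simp add: power_mult_distrib cmod_power2 algebra_simps)
      also have "\<dots> \<le> (\<delta> * Re z)\<^sup>2 + (1 + \<delta> * Im z)\<^sup>2"
        using pos by (intro add_left_mono power_mono) auto
      also have "\<dots> = (norm (1 - \<i> * of_real \<delta> * z))\<^sup>2"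
        unfolding e cmod_power2 by simp
      finally show "norm (1 - \<i> * of_real \<delta> * z) \<ge> \<delta> * norm z"
        by (rule power2_le_imp_le) simp
    qed
    \<comment> \<open>The first entry puts \<open>z0\<close> inside the half disc; the second makes
      \<open>B \<le> \<delta> * R * M\<close>, which is the estimate on the arc.\<close>
    define R where "R = max (norm z0 + 1) (B / (\<delta> * M))"
    have R: "norm z0 < R" "R > 0" "B / (\<delta> * M) \<le> R"
      unfolding R_def using norm_ge_zero[of z0] by (linarith | simp)+
    define S where "S = {z. 0 \<le> Im z} \<inter> cball 0 R"
    define U where "U = {z. 0 < Im z} \<inter> ball 0 R"
    have "closed {z. 0 \<le> Im z}"
      by (intro closed_Collect_le continuous_intros)
    then have "compact S" unfolding S_def by (intro closed_Int_compact) auto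
    moreover have "open U" unfolding U_def by (intro open_Int open_Collect_less continuous_intros) auto
    moreover have "U \<subseteq> S" by (auto simp: U_def S_def)
    moreover have "g holomorphic_on S"
      unfolding g_def S_def using n1
      by (intro holomorphic_intros holomorphic_on_subset[OF hol]) fastforce+
    moreover have "norm (g z) \<le> M" if z: "z \<in> S - U" for z
    proof (cases "Im z = 0")
      case True
      then have "z = of_real (Re z)" by (simp add: complex_eq_iff)
      then have "norm (f z) \<le> M" using real by metis
      moreover have "norm (f z) / norm (1 - \<i> * of_real \<delta> * z) \<le> norm (f z) / 1"
        using n1[of z] True by (intro divide_left_mono) auto
      ultimately show ?thesis by (simp add: g_def norm_divide)
    next
      case False
      then have z': "Im z \<ge> 0" "norm z = R" using z by (auto simp: S_def U_def)
      have "norm (f z) \<le> B" using bnd z' by blast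
      also have "\<dots> \<le> \<delta> * norm z * M" using R(3) z'(2) d M by (simp add: field_simps)
      also have "\<dots> \<le> norm (1 - \<i> * of_real \<delta> * z) * M"
        using nz[OF z'(1)] M by (intro mult_right_mono) auto
      finally show ?thesis using n1[OF z'(1)] unfolding g_def norm_divide
        by (subst pos_divide_le_eq) (auto simp: mult.commute intro: less_le_trans[of 0 1])
    qed
    moreover have "z0 \<in> S" using R z0 by (auto simp: S_def)
    ultimately have "norm (g z0) \<le> M" by (rule maximum_modulus_compact)
    then show ?thesis by (simp add: g_def norm_divide)
  qed
  have "((\<lambda>\<delta>. norm (f z0) / norm (1 - \<i> * of_real \<delta> * z0)) \<longlongrightarrow>
          norm (f z0) / norm (1 - \<i> * of_real 0 * z0)) (at_right 0)"
    by (intro tendsto_intros) auto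
  then have "((\<lambda>\<delta>. norm (f z0) / norm (1 - \<i> * of_real \<delta> * z0)) \<longlongrightarrow> norm (f z0)) (at_right 0)"
    by simp
  then show ?thesis
    by (rule tendsto_upperbound) (use * in \<open>auto simp: eventually_at_filter\<close>)
qed

text \<open>The factor \<open>exp (\<i> * of_real \<sigma> * z)\<close> cancels the growth along the
  positive imaginary axis, so \<open>f\<close> is bounded on the edges of both upper quadrants,
  where the sector lemma applies. This yields only \<open>max M C\<close>; the lemma for bounded
  functions then improves the constant to \<open>M\<close>.\<close>

lemma exp_type_upper_half_plane_bound:
  fixes h :: "complex \<Rightarrow> complex"
  assumes hol: "h holomorphic_on UNIV"
    and growth: "\<And>z. norm (h z) \<le> C * exp (\<sigma> * norm z)" and "\<sigma> \<ge> 0"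
    and real: "\<And>x::real. norm (h (of_real x)) \<le> M" and M: "M > 0"
    and w: "Im w \<ge> 0"
  shows "norm (h w) \<le> M * exp (\<sigma> * Im w)"
proof -
  define f where "f = (\<lambda>z. h z * exp (\<i> * of_real \<sigma> * z))"
  have nf: "norm (f z) = norm (h z) * exp (- \<sigma> * Im z)" for z
    by (simp add: f_def norm_mult)
  have holf: "f holomorphic_on UNIV" unfolding f_def
    by (intro holomorphic_intros hol)
  have C0: "C \<ge> 0" using growth[of 0] by (simp add: order_trans[OF norm_ge_zero])
  have grf: "norm (f z) \<le> C * exp (2 * \<sigma> * norm z)" for z
  proof -
    have "- \<sigma> * Im z \<le> \<sigma> * norm z"
      using mult_left_mono[of "- Im z" "norm z" \<sigma>] abs_Im_le_cmod[of z] \<open>\<sigma> \<ge> 0\<close>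
      by simp
    then have "norm (f z) \<le> C * exp (\<sigma> * norm z) * exp (\<sigma> * norm z)"
      unfolding nf using growth[of z] C0 by (intro mult_mono) auto
    then show ?thesis by (simp add: exp_add[symmetric] mult.assoc)
  qed
  define B where "B = max M C"
  have B: "B > 0" using M by (simp add: B_def)
  have re: "norm (f z) \<le> M" if "Im z = 0" for z
  proof -
    have "z = of_real (Re z)" using that by (simp add: complex_eq_iff)
    then have "norm (h z) \<le> M" using real by metis
    then show ?thesis by (simp add: nf that)
  qed
  have im: "norm (f z) \<le> C" if "Re z = 0" "Im z \<ge> 0" for z
  proof -
    have "norm z = Im z" using that by (simp add: cmod_eq_Im)
    then have "norm (f z) \<le> C * exp (\<sigma> * Im z) * exp (- \<sigma> * Im z)"
      unfolding nf using growth[of z] by (intro mult_right_mono) auto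
    then show ?thesis by (simp add: exp_minus mult.assoc)
  qed
  have bnd: "norm (f z) \<le> B" if "Im z \<ge> 0" for z
  proof -
    \<comment> \<open>Multiplication by \<open>c\<close> rotates the sector
      \<open>\<bar>Im s\<bar> \<le> Re s\<close> by pi/4 or 3*pi/4 onto the quadrant containing
      \<open>z\<close>. Its scaling factor, the square root of 2, is estimated by 2.\<close>
    define c :: complex where "c = (if Re z \<ge> 0 then 1 + \<i> else - 1 + \<i>)"
    have c0: "c \<noteq> 0" and nc: "norm c \<le> 2"
      using norm_triangle_ineq[of 1 \<i>] norm_triangle_ineq[of "-1" \<i>]
      by (auto simp: c_def complex_eq_iff)
    define s where "s = z / c"
    have zs: "z = c * s" using c0 by (simp add: s_def)
    have s: "\<bar>Im s\<bar> \<le> Re s"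
      using zs that by (auto simp: c_def split: if_splits)
    have "norm (f (c * s)) \<le> B"
    proof (rule phragmen_lindelof_sector[where f = "\<lambda>s. f (c * s)", OF _ _ _ B s])
      show "(\<lambda>s. f (c * s)) holomorphic_on UNIV"
        unfolding f_def
        by (intro holomorphic_intros holomorphic_on_compose_gen[OF _ hol, unfolded o_def]) auto
      show "norm (f (c * s)) \<le> C * exp ((4 * \<sigma>) * norm s)" for s
      proof -
        have "2 * \<sigma> * norm (c * s) \<le> 2 * \<sigma> * (2 * norm s)"
          unfolding norm_mult using nc \<open>\<sigma> \<ge> 0\<close> by (intro mult_left_mono mult_right_mono) auto
        then have "C * exp (2 * \<sigma> * norm (c * s)) \<le> C * exp ((4 * \<sigma>) * norm s)"
          using C0 by (intro mult_left_mono) auto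
        then show ?thesis using grf[of "c * s"] by linarith
      qed
      show "norm (f (c * s)) \<le> B" if "\<bar>Im s\<bar> = Re s" for s
      proof -
        have "Im (c * s) = 0 \<or> Re (c * s) = 0 \<and> Im (c * s) \<ge> 0"
          using that by (auto simp: c_def abs_if split: if_splits)
        then show ?thesis using re im unfolding B_def by (meson le_max_iff_disj)
      qed
    qed
    then show ?thesis by (simp add: zs)
  qed
  have "norm (f w) \<le> M"
    by (rule phragmen_lindelof_upper_half_plane_bounded[OF holf bnd _ M w]) (use re in auto)
  then show ?thesis by (simp add: nf exp_minus field_simps)
qed

lemma exp_type_bound:
  fixes h :: "complex \<Rightarrow> complex"
  assumes hol: "h holomorphic_on UNIV"
    and growth: "\<And>z. norm (h z) \<le> C * exp (\<sigma> * norm z)" and s: "\<sigma> \<ge> 0"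
    and real: "\<And>x::real. norm (h (of_real x)) \<le> M"
  shows "norm (h w) \<le> M * exp (\<sigma> * \<bar>Im w\<bar>)"
proof -
  have M0: "M \<ge> 0" using real[of 0] norm_ge_zero order_trans by blast
  \<comment> \<open>A bound strictly above \<open>M\<close> is positive even for
    \<open>M = 0\<close>, as the half plane lemma requires; the limit from the right restores
    \<open>M\<close>. The lower half plane is reached by the reflection of \<open>z\<close> to
    \<open>- z\<close>.\<close>
  have *: "norm (h w) \<le> M' * exp (\<sigma> * \<bar>Im w\<bar>)" if M': "M' > M" for M'
  proof -
    have real': "norm (h (of_real x)) \<le> M'" for x using real[of x] M' by simp
    show ?thesis
    proof (cases "Im w \<ge> 0")
      case True
      then show ?thesis
        using exp_type_upper_half_plane_bound[OF hol growth s real' _ True] M' M0 by simp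
    next
      case False
      have hol': "(\<lambda>z. h (- z)) holomorphic_on UNIV"
        by (intro holomorphic_intros holomorphic_on_compose_gen[OF _ hol, unfolded o_def]) auto
      have growth': "norm (h (- z)) \<le> C * exp (\<sigma> * norm z)" for z
        using growth[of "- z"] by simp
      have "norm (h (- (- w))) \<le> M' * exp (\<sigma> * Im (- w))"
        by (rule exp_type_upper_half_plane_bound[OF hol' growth' s])
           (use real'[of "- _"] M' M0 False in auto)
      then show ?thesis using False by simp
    qed
  qed
  have "((\<lambda>M'. M' * exp (\<sigma> * \<bar>Im w\<bar>)) \<longlongrightarrow> M * exp (\<sigma> * \<bar>Im w\<bar>)) (at_right M)"
    by (intro tendsto_intros)
  then show ?thesis
    by (rule tendsto_lowerbound) (use * in \<open>auto simp: eventually_at_filter\<close>)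
qed

subsection \<open>Exponential type and local means\<close>

text \<open>The Leibniz rule needs the derivative to be jointly continuous, while only
  \<open>f\<close> is assumed to be so. Cauchy's formula over a circle of radius 2 writes the
  derivative on the unit ball as an integral of \<open>f\<close> against a kernel without
  singularities there, and continuity under the integral sign transfers.\<close>

lemma holomorphic_integral_cbox:
  fixes f :: "complex \<Rightarrow> 'b::euclidean_space \<Rightarrow> complex"
  assumes cont: "continuous_on UNIV (\<lambda>(w, t). f w t)"
    and hol: "\<And>t. (\<lambda>w. f w t) holomorphic_on UNIV"
  shows "(\<lambda>w. integral (cbox a b) (f w)) holomorphic_on UNIV"
proof -
  have hol: "(\<lambda>w. f w t) holomorphic_on A" for t A
    using hol[of t] by (rule holomorphic_on_subset) simp
  have contf: "continuous_on A (\<lambda>x. f (g x) (h x))"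
    if "continuous_on A g" "continuous_on A h" for A g h
    using continuous_on_compose2[OF cont, of A "\<lambda>x. (g x, h x)"] that
    by (auto intro: continuous_on_Pair)
  have loc: "(\<lambda>w. integral (cbox a b) (f w)) holomorphic_on ball w0 1" for w0
  proof -
    define k where "k = (\<lambda>w t s. f (circlepath w0 2 s) t / (circlepath w0 2 s - w)\<^sup>2 *
                       (2 * pi * \<i> * 2 * exp (2 * of_real pi * \<i> * s)))"
    define fx where "fx = (\<lambda>w t. 1 / (2 * of_real pi * \<i>) * integral {0..1} (\<lambda>s::real. k w t s))"
    show ?thesis
    proof (rule leibniz_rule_holomorphic[where fx = fx])
      fix w t assume w: "w \<in> ball w0 1"
      have "((\<lambda>w. f w t) has_field_derivative (1 / (2 * of_real pi * \<i>) *
              contour_integral (circlepath w0 2) (\<lambda>u. f u t / (u - w)\<^sup>2))) (at w)"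
        using w by (intro Cauchy_derivative_integral_circlepath hol holomorphic_on_imp_continuous_on) auto
      also have "contour_integral (circlepath w0 2) (\<lambda>u. f u t / (u - w)\<^sup>2) = integral {0..1} (k w t)"
        unfolding contour_integral_integral k_def
        by (intro integral_cong) (simp add: vector_derivative_circlepath01 vector_derivative_circlepath)
      finally show "((\<lambda>w. f w t) has_field_derivative fx w t) (at w within ball w0 1)"
        unfolding fx_def by (rule has_field_derivative_at_within)
    next
      fix w show "f w integrable_on cbox a b"
        by (intro integrable_continuous contf continuous_intros)
    next
      have ne: "circlepath w0 2 s \<noteq> w" if "w \<in> ball w0 1" for s w
      proof
        assume "circlepath w0 2 s = w"
        moreover have "norm (circlepath w0 2 s - w0) = 2"
          by (simp add: circlepath norm_mult)
        ultimately show False using that by (simp add: dist_norm norm_minus_commute)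
      qed
      have "continuous_on ((ball w0 1 \<times> cbox a b) \<times> cbox 0 1) (\<lambda>(x, s). k (fst x) (snd x) s)"
        unfolding k_def split_beta circlepath
        by (intro continuous_intros contf) (use ne in \<open>auto simp: circlepath\<close>)
      from integral_continuous_on_param[OF this]
      show "continuous_on (ball w0 1 \<times> cbox a b) (\<lambda>(w, t). fx w t)"
        unfolding fx_def split_beta by (intro continuous_intros) auto
    qed auto
  qed
  have "(\<lambda>w. integral (cbox a b) (f w)) holomorphic_on (\<Union>w0. ball w0 1)"
    using loc by (intro holomorphic_on_UN_open) auto
  moreover have "(\<Union>w0. ball w0 1) = (UNIV :: complex set)"
    by (force intro: centre_in_ball[THEN iffD2])
  ultimately show ?thesis by simp
qed

section \<open>The real subspace, cubes, and functions of exponential type\<close>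

lemma cvec_add: "cvec (x + y) = cvec x + cvec y"
  by (simp add: cvec_def vec_eq_iff)

lemma cvec_zero [simp]: "cvec 0 = 0"
  by (simp add: cvec_def vec_eq_iff)

lemma cvec_scaleR: "cvec (t *\<^sub>R x) = of_real t *s cvec x"
  by (simp add: cvec_def vec_eq_iff)

lemma norm_cvec [simp]: "norm (cvec x) = norm x"
  by (simp add: cvec_def norm_vec_def)

lemma continuous_on_cvec [continuous_intros]:
  "continuous_on A f \<Longrightarrow> continuous_on A (\<lambda>x. cvec (f x))"
  unfolding cvec_def by (intro continuous_intros)

lemma continuous_on_vector_smult [continuous_intros]:
  fixes f :: "_ \<Rightarrow> complex"
  shows "continuous_on A f \<Longrightarrow> continuous_on A g \<Longrightarrow> continuous_on A (\<lambda>x. f x *s g x)"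
  unfolding vector_scalar_mult_def by (intro continuous_intros)

lemma norm_vector_smult: "norm (c *s (v :: complex^'m)) = norm c * norm v"
  by (simp add: vector_scalar_mult_def norm_vec_def norm_mult L2_set_right_distrib)

lemma One_nth [simp]: "(One :: real^'m) $ i = 1"
  by (simp add: cart_eq_inner_axis inner_sum_left_Basis axis_in_Basis_iff)

lemma sum_Basis_nth [simp]: "(\<Sum>x\<in>Basis. (x :: real^'m) $ i) = 1"
  using One_nth[of i] unfolding sum_component .

lemma cube_subset:
  "a' \<le> a \<Longrightarrow> b \<le> b' \<Longrightarrow>
    cbox (a *\<^sub>R One) (b *\<^sub>R One :: real^'m) \<subseteq> cbox (a' *\<^sub>R One) (b' *\<^sub>R One)"
  by (simp add: mem_box_cart subset_iff) (meson order_trans)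

text \<open>Holomorphy along complex lines plus joint continuity is what the one-variable arguments
  consume, and both pass easily to averages, differences of translates and modulations. The growth
  constant is existential because these operations change it, whereas the estimates derived below
  depend on \<open>b\<close> only.\<close>

definition exp_type :: "real \<Rightarrow> (complex^'m \<Rightarrow> complex) \<Rightarrow> bool" where
  "exp_type b H \<longleftrightarrow> continuous_on UNIV H \<and>
     (\<forall>z v. (\<lambda>w. H (z + w *s v)) holomorphic_on UNIV) \<and>
     (\<exists>C. \<forall>z. norm (H z) \<le> C * exp (b * norm z))"

lemma exp_type_continuous: "exp_type b H \<Longrightarrow> continuous_on A f \<Longrightarrow> continuous_on A (\<lambda>x. H (f x))"
  unfolding exp_type_def by (rule continuous_on_compose2[of UNIV H]) auto

lemma exp_type_holomorphic: "exp_type b H \<Longrightarrow> (\<lambda>w. H (z + w *s v)) holomorphic_on A"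
  unfolding exp_type_def by (metis holomorphic_on_subset subset_UNIV)

lemma exp_type_growth:
  assumes "exp_type b H"
  obtains C where "C \<ge> 0" "\<And>z. norm (H z) \<le> C * exp (b * norm z)"
proof -
  obtain C where C: "\<And>z. norm (H z) \<le> C * exp (b * norm z)"
    using assms by (auto simp: exp_type_def)
  have "C \<ge> 0" using order_trans[OF norm_ge_zero C[of 0]] by simp
  then show ?thesis using C that by blast
qed

text \<open>On the line through \<open>cvec x\<close> in direction \<open>cvec y\<close> the
  function has type \<open>b * norm y\<close>, with a growth constant that deteriorates with
  \<open>x\<close>. This is harmless, since the conclusion of \<open>exp_type_bound\<close> no
  longer contains that constant.\<close>

lemma exp_type_line_bound:
  assumes H: "exp_type b H" and b: "b \<ge> 0" and M: "\<And>x. norm (H (cvec x)) \<le> M"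
  shows "norm (H (cvec x + w *s cvec y)) \<le> M * exp (b * norm y * \<bar>Im w\<bar>)"
proof -
  obtain C where C: "C \<ge> 0" "\<And>z. norm (H z) \<le> C * exp (b * norm z)"
    using exp_type_growth[OF H] by blast
  show ?thesis
  proof (rule exp_type_bound[where h = "\<lambda>w. H (cvec x + w *s cvec y)"])
    show "(\<lambda>w. H (cvec x + w *s cvec y)) holomorphic_on UNIV"
      by (rule exp_type_holomorphic[OF H])
    show "norm (H (cvec x + z *s cvec y)) \<le> (C * exp (b * norm x)) * exp ((b * norm y) * norm z)" for z
    proof -
      have "norm (cvec x + z *s cvec y) \<le> norm x + norm z * norm y"
        using norm_triangle_ineq[of "cvec x" "z *s cvec y"] by (simp add: norm_vector_smult)
      then have "b * norm (cvec x + z *s cvec y) \<le> b * norm x + b * norm y * norm z"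
        using mult_left_mono[OF _ b] by (fastforce simp: algebra_simps)
      then have "exp (b * norm (cvec x + z *s cvec y)) \<le> exp (b * norm x) * exp ((b * norm y) * norm z)"
        by (simp add: exp_add[symmetric])
      from mult_left_mono[OF this C(1)] show ?thesis
        using C(2)[of "cvec x + z *s cvec y"] by (simp add: mult.assoc)
    qed
    show "norm (H (cvec x + of_real t *s cvec y)) \<le> M" for t
      using M[of "x + t *\<^sub>R y"] by (simp add: cvec_add cvec_scaleR)
  qed (use b in auto)
qed

lemma exp_type_tube_bound:
  assumes "exp_type b H" "b \<ge> 0" "\<And>x. norm (H (cvec x)) \<le> M"
  shows "norm (H (cvec x + \<i> *s cvec y)) \<le> M * exp (b * norm y)"
  using exp_type_line_bound[OF assms, of x \<i> y] by simp

text \<open>A Bernstein inequality up to a constant: unit circles centred on the real axis stay in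
  the strip, so Cauchy's estimate bounds the derivative there by \<open>B\<close>.\<close>

lemma strip_bounded_imp_lipschitz:
  assumes hol: "h holomorphic_on UNIV"
    and bnd: "\<And>w. \<bar>Im w\<bar> \<le> 1 \<Longrightarrow> norm (h w) \<le> B"
  shows "norm (h (of_real t) - h 0) \<le> B * \<bar>t\<bar>"
proof -
  have d: "norm (deriv h (of_real s)) \<le> B" for s :: real
  proof -
    have "norm ((deriv ^^ 1) h (of_real s)) \<le> fact 1 * B / 1 ^ 1"
    proof (rule Cauchy_inequality)
      show "norm (h x) \<le> B" if "norm (of_real s - x) = 1" for x
        using abs_Im_le_cmod[of "of_real s - x"] that by (intro bnd) simp
    qed (auto intro: holomorphic_on_subset[OF hol] holomorphic_on_imp_continuous_on)
    then show ?thesis by simp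
  qed
  have "norm (h (of_real t) - h 0) \<le> B * norm (of_real t - (0::complex))"
  proof (rule field_differentiable_bound[where S = "closed_segment 0 (of_real t)" and f' = "deriv h"])
    fix z :: complex assume z: "z \<in> closed_segment 0 (of_real t)"
    show "(h has_field_derivative deriv h z) (at z within closed_segment 0 (of_real t))"
      using hol by (simp add: holomorphic_derivI has_field_derivative_at_within)
    obtain u where "z = of_real (u * t)" using z by (auto simp: in_segment scaleR_conv_of_real)
    then show "norm (deriv h z) \<le> B" using d by metis
  qed auto
  then show ?thesis by simp
qed

lemma exp_type_lipschitz:
  assumes H: "exp_type b H" and b: "b \<ge> 0" and M: "\<And>x. norm (H (cvec x)) \<le> M"
  shows "norm (H (cvec (x + v)) - H (cvec x)) \<le> M * exp b * norm v"
proof (cases "v = 0")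
  case False
  \<comment> \<open>Along a unit direction the type is \<open>b\<close>, so the strip of half-width
    1 costs the factor \<open>exp b\<close> whatever the length of \<open>v\<close>.\<close>
  define e where "e = v /\<^sub>R norm v"
  have e: "norm e = 1" "v = norm v *\<^sub>R e" using False by (auto simp: e_def)
  have M0: "M \<ge> 0" using M[of 0] norm_ge_zero order_trans by blast
  have "norm (H (cvec x + of_real (norm v) *s cvec e) - H (cvec x + 0 *s cvec e)) \<le> M * exp b * \<bar>norm v\<bar>"
  proof (rule strip_bounded_imp_lipschitz[where h = "\<lambda>w. H (cvec x + w *s cvec e)"])
    show "(\<lambda>w. H (cvec x + w *s cvec e)) holomorphic_on UNIV"
      by (rule exp_type_holomorphic[OF H])
    fix w assume w: "\<bar>Im w\<bar> \<le> 1"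
    have "norm (H (cvec x + w *s cvec e)) \<le> M * exp (b * norm e * \<bar>Im w\<bar>)"
      by (rule exp_type_line_bound[OF H b M])
    also have "\<dots> \<le> M * exp b" using M0 e w b mult_left_mono[OF w b] by (intro mult_left_mono) auto
    finally show "norm (H (cvec x + w *s cvec e)) \<le> M * exp b" .
  qed
  moreover have "cvec (x + v) = cvec x + of_real (norm v) *s cvec e"
    by (subst e(2)) (simp add: cvec_add cvec_scaleR)
  ultimately show ?thesis by simp
qed simp

lemma content_cube:
  assumes "a \<le> b"
  shows "measure lborel (cbox (a *\<^sub>R One) (b *\<^sub>R One :: real^'m)) = (b - a) ^ CARD('m)"
proof -
  have "cbox (a *\<^sub>R One) (b *\<^sub>R One :: real^'m) \<noteq> {}"
    using assms by (simp add: interval_ne_empty_cart)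
  then show ?thesis by (simp add: content_cbox_cart)
qed

lemma exp_type_average:
  assumes H: "exp_type b H" and b: "b \<ge> 0"
  shows "exp_type b (\<lambda>z. k * integral (cbox a c) (\<lambda>u. H (z + cvec u)))"
  unfolding exp_type_def
proof (intro conjI allI)
  have "continuous_on (UNIV \<times> cbox a c) (\<lambda>(z, u). H (z + cvec u))"
    unfolding split_beta by (intro exp_type_continuous[OF H] continuous_intros)
  from integral_continuous_on_param[OF this]
  show "continuous_on UNIV (\<lambda>z. k * integral (cbox a c) (\<lambda>u. H (z + cvec u)))"
    by (intro continuous_intros)
  show "(\<lambda>w. k * integral (cbox a c) (\<lambda>u. H (z + w *s v + cvec u))) holomorphic_on UNIV" for z v
  proof (intro holomorphic_intros holomorphic_integral_cbox)
    show "continuous_on UNIV (\<lambda>(w, u). H (z + w *s v + cvec u))"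
      unfolding split_beta by (intro exp_type_continuous[OF H] continuous_intros)
    show "(\<lambda>w. H (z + w *s v + cvec u)) holomorphic_on UNIV" for u
      using exp_type_holomorphic[OF H, of "z + cvec u" v] by (simp add: add_ac)
  qed
  obtain C where C: "C \<ge> 0" "\<And>z. norm (H z) \<le> C * exp (b * norm z)"
    using exp_type_growth[OF H] by blast
  obtain R where R: "\<And>u. u \<in> cbox a c \<Longrightarrow> norm u \<le> R"
    using bounded_cbox[of a c] by (auto simp: bounded_iff)
  show "\<exists>C. \<forall>z. norm (k * integral (cbox a c) (\<lambda>u. H (z + cvec u))) \<le> C * exp (b * norm z)"
  proof (intro exI allI)
    fix z
    have "norm (integral (cbox a c) (\<lambda>u. H (z + cvec u))) \<le>
          integral (cbox a c) (\<lambda>u. C * exp (b * R) * exp (b * norm z))"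
    proof (rule integral_norm_bound_integral)
      show "(\<lambda>u. H (z + cvec u)) integrable_on cbox a c"
        by (intro integrable_continuous exp_type_continuous[OF H] continuous_intros)
      fix u assume "u \<in> cbox a c"
      then have "norm (z + cvec u) \<le> norm z + R"
        using norm_triangle_ineq[of z "cvec u"] R[of u] by simp
      then have "b * norm (z + cvec u) \<le> b * R + b * norm z"
        using mult_left_mono[OF _ b] by (fastforce simp: algebra_simps)
      then have "C * exp (b * norm (z + cvec u)) \<le> C * exp (b * R) * exp (b * norm z)"
        using C by (simp add: mult.assoc exp_add[symmetric] mult_left_mono)
      then show "norm (H (z + cvec u)) \<le> C * exp (b * R) * exp (b * norm z)"
        using C(2)[of "z + cvec u"] by simp
    qed auto
    then have "norm k * norm (integral (cbox a c) (\<lambda>u. H (z + cvec u))) \<le>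
        norm k * (measure lborel (cbox a c) * (C * exp (b * R) * exp (b * norm z)))"
      by (intro mult_left_mono) (simp_all add: mult_ac)
    then show "norm (k * integral (cbox a c) (\<lambda>u. H (z + cvec u))) \<le>
        (norm k * measure lborel (cbox a c) * C * exp (b * R)) * exp (b * norm z)"
      by (simp add: norm_mult mult_ac)
  qed
qed

lemma norm_le_card_mult:
  fixes v :: "real^'m"
  assumes "v \<in> cbox 0 (d *\<^sub>R One)"
  shows "norm v \<le> real CARD('m) * d"
proof -
  have v: "\<bar>v $ i\<bar> \<le> d" for i using assms by (simp add: mem_box_cart)
  have "norm v \<le> (\<Sum>i\<in>UNIV. \<bar>v $ i\<bar>)" by (rule norm_le_l1_cart)
  also have "\<dots> \<le> (\<Sum>i\<in>(UNIV::'m set). d)" using v by (intro sum_mono) auto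
  finally show ?thesis by simp
qed

text \<open>By the Lipschitz bound, \<open>norm H\<close> varies by at most half its supremum over a small cube,
  so the supremum is absorbed by the mean over that cube.\<close>

lemma bounded_exp_type_local_mean_bound:
  fixes H :: "complex^'m \<Rightarrow> complex"
  assumes H: "exp_type b H" and b: "b \<ge> 0"
    and bnd: "\<And>x. norm (H (cvec x)) \<le> M0"
    and S: "\<And>x. integral (cbox 0 One) (\<lambda>u. norm (H (cvec (x + u)))) \<le> S"
    and d: "0 < d" "d \<le> 1" "exp b * (real CARD('m) * d) \<le> 1 / 2"
  shows "norm (H (cvec x)) \<le> 2 * S / d ^ CARD('m)"
proof -
  \<comment> \<open>The true supremum, because only it can be compared with itself: the estimate
    \<open>half\<close> bounds every value, hence \<open>M\<close>, by a term containing
    \<open>M / 2\<close>. The bound \<open>M0\<close> serves to make it finite.\<close>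
  define M where "M = (SUP x. norm (H (cvec x)))"
  have bdd: "bdd_above (range (\<lambda>x. norm (H (cvec x))))" using bnd by (auto intro!: bdd_aboveI[of _ M0])
  have M: "norm (H (cvec x)) \<le> M" for x
    unfolding M_def using bdd by (rule cSUP_upper2) auto
  have M0: "M \<ge> 0" using M[of 0] norm_ge_zero order_trans by blast
  let ?Q = "cbox 0 (d *\<^sub>R One) :: (real^'m) set"
  have cont: "continuous_on A (\<lambda>u. norm (H (cvec (x + u))))" for A x
    by (intro exp_type_continuous[OF H] continuous_intros)
  have dm: "d ^ CARD('m) > 0" using d by simp
  have vol: "measure lborel ?Q = d ^ CARD('m)"
    using content_cube[of 0 d, where 'm = 'm] d by simp
  have half: "norm (H (cvec x)) \<le> S / d ^ CARD('m) + M / 2" for x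
  proof -
    have "integral ?Q (\<lambda>u. norm (H (cvec x)) - M / 2) \<le> integral ?Q (\<lambda>u. norm (H (cvec (x + u))))"
    proof (intro integral_le integrable_continuous cont continuous_intros)
      fix u assume u: "u \<in> ?Q"
      have "norm (H (cvec (x + u)) - H (cvec x)) \<le> M * exp b * norm u"
        by (rule exp_type_lipschitz[OF H b M])
      also have "\<dots> = M * (exp b * norm u)" by simp
      also have "\<dots> \<le> M * (exp b * (real CARD('m) * d))"
        using M0 norm_le_card_mult[OF u] by (intro mult_left_mono) auto
      also have "\<dots> \<le> M * (1 / 2)" using d M0 by (intro mult_left_mono) auto
      finally show "norm (H (cvec x)) - M / 2 \<le> norm (H (cvec (x + u)))"
        using norm_triangle_ineq2[of "H (cvec x)" "H (cvec (x + u))"] by (simp add: norm_minus_commute)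
    qed
    also have "\<dots> \<le> integral (cbox 0 One) (\<lambda>u. norm (H (cvec (x + u))))"
      using d by (intro integral_subset_le integrable_continuous cont)
        (use cube_subset[of 0 0 d 1, where 'm = 'm] in auto)
    also have "\<dots> \<le> S" by (rule S)
    finally have "(norm (H (cvec x)) - M / 2) * d ^ CARD('m) \<le> S" by (simp add: vol mult.commute)
    then show ?thesis using pos_le_divide_eq[OF dm] by (smt (verit))
  qed
  have "M \<le> S / d ^ CARD('m) + M / 2"
    unfolding M_def by (rule cSUP_least) (use half in \<open>auto simp: M_def\<close>)
  then show ?thesis using M[of x] by (simp add: field_simps)
qed

lemma average_near_value:
  fixes g :: "real^'m \<Rightarrow> complex"
  assumes cont: "continuous_on UNIV g" and e: "e > 0"
    and near: "\<And>u. u \<in> cbox 0 (e *\<^sub>R One) \<Longrightarrow> norm (g u - c) \<le> r"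
  shows "norm (of_real (1 / e ^ CARD('m)) * integral (cbox 0 (e *\<^sub>R One)) g - c) \<le> r"
proof -
  let ?Q = "cbox 0 (e *\<^sub>R One) :: (real^'m) set"
  have vol: "measure lborel ?Q = e ^ CARD('m)"
    using content_cube[of 0 e, where 'm = 'm] e by simp
  have em: "e ^ CARD('m) > 0" using e by simp
  have gi: "g integrable_on ?Q"
    using cont by (intro integrable_continuous continuous_on_subset[OF cont]) auto
  have "norm (integral ?Q (\<lambda>u. g u - c)) \<le> integral ?Q (\<lambda>u. r)"
    using near gi by (intro integral_norm_bound_integral integrable_diff) auto
  also have "integral ?Q (\<lambda>u. g u - c) = integral ?Q g - of_real (e ^ CARD('m)) * c"
    using gi by (subst integral_diff) (auto simp: vol scaleR_conv_of_real[of _ c])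
  finally have "norm (integral ?Q g - of_real (e ^ CARD('m)) * c) / e ^ CARD('m) \<le> r"
    using em by (simp add: vol field_simps)
  moreover have "of_real (1 / e ^ CARD('m)) * integral ?Q g - c =
     of_real (1 / e ^ CARD('m)) * (integral ?Q g - of_real (e ^ CARD('m)) * c)"
    using em e by (simp add: algebra_simps)
  ultimately show ?thesis using em e by (simp only: norm_mult) (simp add: norm_divide norm_power)
qed

text \<open>Boundedness on the real subspace, without which the supremum cannot be absorbed, is obtained
  by first averaging \<open>H\<close> over a cube of side \<open>e\<close>; the resulting bound does not depend on \<open>e\<close>.\<close>

lemma exp_type_local_mean_bound:
  fixes H :: "complex^'m \<Rightarrow> complex"
  assumes H: "exp_type b H" and b: "b \<ge> 0"
    and S: "\<And>x. integral (cbox 0 One) (\<lambda>u. norm (H (cvec (x + u)))) \<le> S"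
    and d: "0 < d" "d \<le> 1" "exp b * (real CARD('m) * d) \<le> 1 / 2"
  shows "norm (H (cvec x)) \<le> 2 * S / d ^ CARD('m)"
proof (rule field_le_epsilon)
  fix \<eta> :: real assume \<eta>: "\<eta> > 0"
  have "continuous (at 0) (\<lambda>u. H (cvec (x + u)))"
    using exp_type_continuous[OF H, of UNIV "\<lambda>u. cvec (x + u)"]
    by (simp add: continuous_intros continuous_on_eq_continuous_at)
  then obtain r where r: "r > 0" "\<And>u. norm u < r \<Longrightarrow> norm (H (cvec (x + u)) - H (cvec x)) < \<eta>"
    using \<eta> by (auto simp: continuous_at_eps_delta dist_norm)
  \<comment> \<open>The cube of side \<open>e\<close> must lie in the ball of radius
    \<open>r\<close>, where \<open>H\<close> is within \<eta> of its value at \<open>cvec x\<close>;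
    the factor 2 makes this strict. The cap 1 places it inside the unit cube.\<close>
  define e where "e = min 1 (r / (2 * real CARD('m)))"
  have e: "e > 0" "e \<le> 1" using r by (auto simp: e_def)
  have er: "real CARD('m) * e < r"
  proof -
    have "real CARD('m) * e \<le> real CARD('m) * (r / (2 * real CARD('m)))"
      unfolding e_def by (intro mult_left_mono) auto
    then show ?thesis using r by simp
  qed
  let ?Q = "cbox 0 (e *\<^sub>R One) :: (real^'m) set"
  let ?k = "1 / e ^ CARD('m)"
  have vol: "measure lborel ?Q = e ^ CARD('m)"
    using content_cube[of 0 e, where 'm = 'm] e by simp
  have em: "e ^ CARD('m) > 0" using e by simp
  define G where "G = (\<lambda>z. of_real ?k * integral ?Q (\<lambda>u. H (z + cvec u)))"
  have G: "exp_type b G" unfolding G_def by (rule exp_type_average[OF H b])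
  have cont: "continuous_on A (\<lambda>u. H (cvec (f u)))" if "continuous_on A f" for A and f :: "_ \<Rightarrow> real^'m"
    using that by (intro exp_type_continuous[OF H] continuous_intros)
  have Gle: "norm (G (cvec y)) \<le> ?k * integral ?Q (\<lambda>u. norm (H (cvec (y + u))))" for y
  proof -
    have "norm (integral ?Q (\<lambda>u. H (cvec (y + u)))) \<le> integral ?Q (\<lambda>u. norm (H (cvec (y + u))))"
      by (intro integral_norm_bound_integral integrable_continuous cont continuous_intros) auto
    then have "?k * norm (integral ?Q (\<lambda>u. H (cvec (y + u)))) \<le> ?k * integral ?Q (\<lambda>u. norm (H (cvec (y + u))))"
      using em by (intro mult_left_mono) auto
    then show ?thesis unfolding G_def cvec_add[symmetric] norm_mult norm_of_real using em by simp
  qed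
  have "norm (G (cvec x)) \<le> 2 * S / d ^ CARD('m)"
  proof (rule bounded_exp_type_local_mean_bound[OF G b _ _ d])
    \<comment> \<open>This bound blows up as \<open>e\<close> tends to 0, but it is needed only as
      evidence that the supremum of \<open>G\<close> is finite.\<close>
    show "norm (G (cvec y)) \<le> ?k * S" for y
    proof -
      have "integral ?Q (\<lambda>u. norm (H (cvec (y + u)))) \<le> integral (cbox 0 One) (\<lambda>u. norm (H (cvec (y + u))))"
        using e by (intro integral_subset_le integrable_continuous cont continuous_intros)
          (use cube_subset[of 0 0 e 1, where 'm = 'm] in auto)
      also have "\<dots> \<le> S" by (rule S)
      finally show ?thesis using Gle[of y] em
        by (meson divide_nonneg_pos mult_left_mono order_trans zero_le_one)
    qed
    \<comment> \<open>Exchanging the integrals turns the local mean of \<open>G\<close> into an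
      average over \<open>v\<close> of local means of \<open>H\<close> at shifted points. Hence the
      same \<open>S\<close> works, independently of \<open>e\<close>.\<close>
    show "integral (cbox 0 One) (\<lambda>u. norm (G (cvec (y + u)))) \<le> S" for y
    proof -
      have "integral (cbox 0 One) (\<lambda>u. norm (G (cvec (y + u)))) \<le>
            integral (cbox 0 One) (\<lambda>u. ?k * integral ?Q (\<lambda>v. norm (H (cvec (y + u + v)))))"
      proof (intro integral_le Gle)
        show "(\<lambda>u. norm (G (cvec (y + u)))) integrable_on cbox 0 One"
          by (intro integrable_continuous exp_type_continuous[OF G] continuous_intros)
        have "continuous_on (cbox 0 One \<times> ?Q) (\<lambda>(u, v). norm (H (cvec (y + u + v))))"
          unfolding split_beta by (intro cont continuous_intros)
        from integral_continuous_on_param[OF this]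
        show "(\<lambda>u. ?k * integral ?Q (\<lambda>v. norm (H (cvec (y + u + v))))) integrable_on cbox 0 One"
          by (intro integrable_continuous continuous_intros)
      qed
      also have "\<dots> = ?k * integral (cbox 0 One) (\<lambda>u. integral ?Q (\<lambda>v. norm (H (cvec (y + u + v)))))"
        by (rule integral_mult_right)
      also have "integral (cbox 0 One) (\<lambda>u. integral ?Q (\<lambda>v. norm (H (cvec (y + u + v))))) =
                 integral ?Q (\<lambda>v. integral (cbox 0 One) (\<lambda>u. norm (H (cvec (y + u + v)))))"
        unfolding split_beta by (intro integral_swap_continuous) (unfold split_beta, intro cont continuous_intros)
      also have "\<dots> \<le> integral ?Q (\<lambda>v. S)"
      proof (rule integral_le)
        have "continuous_on (?Q \<times> cbox 0 One) (\<lambda>(v, u). norm (H (cvec (y + u + v))))"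
          unfolding split_beta by (intro cont continuous_intros)
        from integral_continuous_on_param[OF this]
        show "(\<lambda>v. integral (cbox 0 One) (\<lambda>u. norm (H (cvec (y + u + v))))) integrable_on ?Q"
          by (intro integrable_continuous)
        show "integral (cbox 0 One) (\<lambda>u. norm (H (cvec (y + u + v)))) \<le> S" for v
          using S[of "y + v"] by (simp add: add_ac)
      qed auto
      finally show ?thesis using em e by (simp add: vol divide_right_mono)
    qed
  qed
  moreover have "norm (G (cvec x) - H (cvec x)) \<le> \<eta>"
    unfolding G_def cvec_add[symmetric]
  proof (rule average_near_value)
    fix u assume "u \<in> ?Q"
    then have "norm u < r" using norm_le_card_mult er by fastforce
    then show "norm (H (cvec (x + u)) - H (cvec x)) \<le> \<eta>" using r(2) by (simp add: less_imp_le)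
  qed (use e in \<open>auto intro!: cont continuous_intros\<close>)
  ultimately show "norm (H (cvec x)) \<le> 2 * S / d ^ CARD('m) + \<eta>"
    using norm_triangle_ineq2[of "H (cvec x)" "G (cvec x)"] by (simp add: norm_minus_commute)
qed

text \<open>The mesh \<open>d\<close>, and with it \<open>K\<close>, depends on \<open>b\<close> and
  the dimension alone. Uniformity in \<open>H\<close> is what matters: the functions
  \<open>F(z + \<tau>) - F(z)\<close> for all \<tau> are estimated with one constant.\<close>

lemma exp_type_local_mean_constant:
  assumes b: "b \<ge> 0"
  obtains K :: real where "K > 0"
    and "\<And>(H :: complex^'m \<Rightarrow> complex) S x. exp_type b H \<Longrightarrow>
      (\<And>x. integral (cbox 0 One) (\<lambda>u. norm (H (cvec (x + u)))) \<le> S) \<Longrightarrow> norm (H (cvec x)) \<le> K * S"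
proof
  define d where "d = 1 / (2 * exp b * real CARD('m))"
  have "1 * 1 \<le> exp b * real CARD('m)" using b by (intro mult_mono) auto
  then have d: "0 < d" "d \<le> 1" "exp b * (real CARD('m) * d) \<le> 1 / 2" by (auto simp: d_def)
  show "2 / d ^ CARD('m) > 0" using d by simp
  show "norm (H (cvec x)) \<le> 2 / d ^ CARD('m) * S"
    if "exp_type b H" "\<And>x. integral (cbox 0 One) (\<lambda>u. norm (H (cvec (x + u)))) \<le> S"
    for H :: "complex^'m \<Rightarrow> complex" and S x
    using exp_type_local_mean_bound[OF that(1) b that(2) d] by simp
qed

subsection \<open>Mean values over cubes\<close>

definition cube_mean :: "real \<Rightarrow> (real^'m \<Rightarrow> complex) \<Rightarrow> complex" where
  "cube_mean N g = integral (cbox (- (N *\<^sub>R One)) (N *\<^sub>R One)) g / complex_of_real ((2 * N) ^ CARD('m))"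

lemma content_centred_cube:
  "N \<ge> 0 \<Longrightarrow> measure lborel (cbox (- (N *\<^sub>R One)) (N *\<^sub>R One :: real^'m)) = (2 * N) ^ CARD('m)"
  using content_cube[of "- N" N, where 'm = 'm] by simp

lemma cube_mean_near:
  fixes g :: "real^'m \<Rightarrow> complex"
  assumes N: "N > 0" and cont: "continuous_on UNIV g" and near: "\<And>x. norm (g x - c) \<le> r"
  shows "norm (cube_mean N g - c) \<le> r"
proof -
  let ?Q = "cbox (- (N *\<^sub>R One)) (N *\<^sub>R One) :: (real^'m) set"
  have vol: "measure lborel ?Q = (2 * N) ^ CARD('m)"
    using N by (intro content_centred_cube) simp
  have em: "(2 * N) ^ CARD('m) > 0" using N by simp
  have gi: "g integrable_on ?Q"
    by (intro integrable_continuous continuous_on_subset[OF cont]) auto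
  have "norm (integral ?Q (\<lambda>u. g u - c)) \<le> integral ?Q (\<lambda>u. r)"
    using near gi by (intro integral_norm_bound_integral integrable_diff) auto
  also have "integral ?Q (\<lambda>u. g u - c) = integral ?Q g - of_real ((2 * N) ^ CARD('m)) * c"
    using gi by (subst integral_diff) (simp_all only: integrable_const integral_const vol scaleR_conv_of_real[of _ c])
  also have "integral ?Q (\<lambda>u. r) = (2 * N) ^ CARD('m) * r" by (simp only: integral_const vol) simp
  finally have "norm (integral ?Q g - of_real ((2 * N) ^ CARD('m)) * c) / (2 * N) ^ CARD('m) \<le> r"
    by (subst pos_divide_le_eq[OF em]) (simp add: mult.commute)
  moreover have "cube_mean N g - c =
     (integral ?Q g - of_real ((2 * N) ^ CARD('m)) * c) / of_real ((2 * N) ^ CARD('m))"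
    unfolding cube_mean_def using em N by (simp add: diff_divide_distrib)
  ultimately show ?thesis using em N by (simp only: norm_divide norm_of_real abs_of_pos)
qed

lemma norm_cube_mean_le:
  assumes "N > 0" "continuous_on UNIV g" "\<And>x. norm (g x) \<le> B"
  shows "norm (cube_mean N g) \<le> B"
  using cube_mean_near[of N g 0 B] assms by simp

lemma integral_subcbox_diff_bound:
  fixes g :: "'a::euclidean_space \<Rightarrow> complex"
  assumes cont: "continuous_on UNIV g" and B: "\<And>x. norm (g x) \<le> B"
    and sub: "cbox a b \<subseteq> cbox c d"
  shows "norm (integral (cbox c d) g - integral (cbox a b) g) \<le>
          B * (measure lborel (cbox c d) - measure lborel (cbox a b))"
proof -
  let ?P = "cbox a b" and ?Q = "cbox c d"
  have int: "h integrable_on cbox u v" if "continuous_on UNIV h" for h :: "'a \<Rightarrow> 'b::banach" and u v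
    by (intro integrable_continuous continuous_on_subset[OF that]) auto
  have restr: "integral ?Q (\<lambda>x. if x \<in> ?P then h x else 0) = integral ?P h"
       "(\<lambda>x. if x \<in> ?P then h x else 0) integrable_on ?Q" if "continuous_on UNIV h" for h :: "'a \<Rightarrow> 'b::banach"
    using integral_restrict_Int[of ?Q ?P h] integrable_restrict_Int[of ?P h ?Q] int[OF that] sub
    by (simp_all add: Int_absorb2)
  have "norm (integral ?Q (\<lambda>x. g x - (if x \<in> ?P then g x else 0))) \<le>
        integral ?Q (\<lambda>x. B - (if x \<in> ?P then B else 0))"
    using B by (intro integral_norm_bound_integral integrable_diff restr int cont continuous_intros) auto
  also have "integral ?Q (\<lambda>x. g x - (if x \<in> ?P then g x else 0)) = integral ?Q g - integral ?P g"
    using restr[OF cont] int[OF cont] by (simp add: integral_diff)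
  also have "integral ?Q (\<lambda>x. B - (if x \<in> ?P then B else 0)) = B * (measure lborel ?Q - measure lborel ?P)"
    using restr[of "\<lambda>_. B"] by (subst integral_diff) (auto simp: algebra_simps)
  finally show ?thesis .
qed

text \<open>The cube of half-side \<open>N\<close> and its translate by \<open>v\<close> share the
  concentric cube of half-side \<open>N - s\<close>, and by Bernoulli's inequality each loses at
  most the fraction \<open>CARD('m) * s / N\<close> of its volume. For \<open>s > N\<close> the
  trivial bound \<open>2 * B\<close> is already small enough.\<close>

lemma cube_mean_shift:
  fixes g :: "real^'m \<Rightarrow> complex"
  assumes N: "N > 0" and cont: "continuous_on UNIV g" and B: "\<And>x. norm (g x) \<le> B"
    and v: "norm v \<le> s"
  shows "norm (cube_mean N (\<lambda>x. g (v + x)) - cube_mean N g) \<le> 2 * B * real CARD('m) * s / N"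
proof -
  have s: "s \<ge> 0" using v norm_ge_zero order_trans by blast
  have B0: "B \<ge> 0" using B[of 0] norm_ge_zero order_trans by blast
  have vi: "\<bar>v $ i\<bar> \<le> s" for i using component_le_norm_cart[of v i] v by linarith
  have cont': "continuous_on UNIV (\<lambda>x. g (v + x))"
    by (intro continuous_on_compose2[OF cont] continuous_intros) auto
  show ?thesis
  proof (cases "s \<le> N")
    case False
    have "norm (cube_mean N (\<lambda>x. g (v + x)) - cube_mean N g) \<le> B + B"
      by (intro order_trans[OF norm_triangle_ineq4] add_mono norm_cube_mean_le N cont cont' B)
    also have "\<dots> = 2 * B * 1 * N / N" using N by simp
    also have "\<dots> \<le> 2 * B * real CARD('m) * s / N"
      using False B0 N s by (intro divide_right_mono mult_mono) auto
    finally show ?thesis .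
  next
    case True
    let ?Q = "cbox (- (N *\<^sub>R One)) (N *\<^sub>R One) :: (real^'m) set"
    let ?Q' = "cbox (- (N *\<^sub>R One) + v) (N *\<^sub>R One + v) :: (real^'m) set"
    let ?P = "cbox (- ((N - s) *\<^sub>R One)) ((N - s) *\<^sub>R One) :: (real^'m) set"
    let ?V = "(2 * N) ^ CARD('m)"
    have V: "?V > 0" using N by simp
    have volQ: "measure lborel ?Q = ?V" using N by (intro content_centred_cube) simp
    have volP: "measure lborel ?P = (2 * (N - s)) ^ CARD('m)" using True by (intro content_centred_cube) simp
    have "?Q' \<noteq> {}" using N by (simp add: interval_ne_empty_cart)
    then have volQ': "measure lborel ?Q' = ?V" by (simp add: content_cbox_cart)
    have PQ: "?P \<subseteq> ?Q" unfolding scaleR_minus_left[symmetric] by (intro cube_subset) (use s in auto)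
    have PQ': "?P \<subseteq> ?Q'"
    proof
      fix x assume "x \<in> ?P"
      then have "- (N - s) \<le> x $ i \<and> x $ i \<le> N - s" for i by (simp add: mem_box_cart)
      then have "- N + v $ i \<le> x $ i \<and> x $ i \<le> N + v $ i" for i
        using vi[of i] by (smt (verit))
      then show "x \<in> ?Q'" by (simp add: mem_box_cart)
    qed
    have shift: "integral ?Q (\<lambda>x. g (v + x)) = integral ?Q' g"
      using integral_shift_cbox_plus[of "- (N *\<^sub>R One)" "N *\<^sub>R One" g v] by (simp add: o_def)
    define q where "q = s / N"
    have q: "0 \<le> q" "q \<le> 1" using s True N by (auto simp: q_def)
    have "?V - measure lborel ?P \<le> ?V * (real CARD('m) * q)"
    proof -
      have "2 * (N - s) = 2 * N * (1 - q)" using N by (simp add: q_def field_simps)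
      then have "measure lborel ?P = ?V * (1 - q) ^ CARD('m)" unfolding volP by (metis power_mult_distrib)
      moreover have "1 + real CARD('m) * (- q) \<le> (1 + - q) ^ CARD('m)"
        using q by (intro Bernoulli_inequality) simp
      then have "?V * (1 + real CARD('m) * (- q)) \<le> ?V * (1 - q) ^ CARD('m)"
        using V by (intro mult_left_mono) auto
      ultimately show ?thesis by (simp add: algebra_simps)
    qed
    then have BV: "B * (?V - measure lborel ?P) \<le> B * (?V * (real CARD('m) * q))"
      using B0 by (intro mult_left_mono) auto
    have "norm (integral ?Q' g - integral ?Q g) \<le>
        norm (integral ?Q' g - integral ?P g) + norm (integral ?Q g - integral ?P g)"
      using norm_triangle_ineq4[of "integral ?Q' g - integral ?P g" "integral ?Q g - integral ?P g"] by simp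
    also have "\<dots> \<le> B * (?V - measure lborel ?P) + B * (?V - measure lborel ?P)"
      using integral_subcbox_diff_bound[OF cont B PQ] integral_subcbox_diff_bound[OF cont B PQ']
      unfolding volQ volQ' by linarith
    also have "\<dots> \<le> B * (?V * (real CARD('m) * q)) + B * (?V * (real CARD('m) * q))"
      using BV by linarith
    also have "\<dots> = 2 * B * real CARD('m) * s / N * ?V" by (simp add: q_def)
    finally have "norm (integral ?Q' g - integral ?Q g) / ?V \<le> 2 * B * real CARD('m) * s / N"
      by (subst pos_divide_le_eq[OF V])
    then show ?thesis
      unfolding cube_mean_def shift diff_divide_distrib[symmetric] norm_divide norm_of_real abs_of_pos[OF V] .
  qed
qed

text \<open>The double mean over cubes of half-sides \<open>N\<close> and \<open>N'\<close> is close to each of the two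
  single means, which makes the means a Cauchy family without any tiling of cubes.\<close>

lemma cube_mean_convergent:
  fixes g :: "real^'m \<Rightarrow> complex"
  assumes cont: "continuous_on UNIV g" and B: "\<And>x. norm (g x) \<le> B"
    and net: "\<And>\<epsilon>. \<epsilon> > 0 \<Longrightarrow> \<exists>R. \<forall>a. \<exists>j. norm j \<le> R \<and> (\<forall>x. norm (g (a + x) - g (j + x)) \<le> \<epsilon>)"
  obtains L where "((\<lambda>N. cube_mean N g) \<longlongrightarrow> L) at_top"
proof -
  have B0: "B \<ge> 0" using B[of 0] norm_ge_zero order_trans by blast
  have cont': "continuous_on A (\<lambda>x. g (f x))" if "continuous_on A f" for A and f :: "'b::topological_space \<Rightarrow> real^'m"
    using that by (intro continuous_on_compose2[OF cont]) auto
  \<comment> \<open>Replacing \<open>a\<close> by its bounded representative \<open>j\<close> costs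
    \<epsilon>, and undoing the shift by \<open>j\<close> costs \<open>K / N\<close>. The constant
    depends on \<epsilon> but not on \<open>a\<close>, which permits averaging over \<open>a\<close>
    afterwards.\<close>
  have unif: "\<exists>K\<ge>0. \<forall>N>0. \<forall>a. norm (cube_mean N (\<lambda>x. g (a + x)) - cube_mean N g) \<le> \<epsilon> + K / N"
    if \<epsilon>: "\<epsilon> > 0" for \<epsilon>
  proof -
    obtain R where R: "\<And>a. \<exists>j. norm j \<le> R \<and> (\<forall>x. norm (g (a + x) - g (j + x)) \<le> \<epsilon>)"
      using net[OF \<epsilon>] by blast
    have R0: "R \<ge> 0" using R[of 0] norm_ge_zero order_trans by blast
    have "norm (cube_mean N (\<lambda>x. g (a + x)) - cube_mean N g) \<le> \<epsilon> + (2 * B * real CARD('m) * R) / N"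
      if N: "N > 0" for N a
    proof -
      obtain j where j: "norm j \<le> R" "\<And>x. norm (g (a + x) - g (j + x)) \<le> \<epsilon>" using R by blast
      have "cube_mean N (\<lambda>x. g (a + x) - g (j + x)) = cube_mean N (\<lambda>x. g (a + x)) - cube_mean N (\<lambda>x. g (j + x))"
        unfolding cube_mean_def diff_divide_distrib[symmetric]
        by (subst integral_diff) (auto intro!: integrable_continuous cont' continuous_intros)
      moreover have "norm (cube_mean N (\<lambda>x. g (a + x) - g (j + x))) \<le> \<epsilon>"
        by (intro norm_cube_mean_le N j cont' continuous_intros)
      ultimately have "norm (cube_mean N (\<lambda>x. g (a + x)) - cube_mean N (\<lambda>x. g (j + x))) \<le> \<epsilon>" by simp
      with cube_mean_shift[OF N cont B j(1)] show ?thesis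
        using norm_triangle_ineq[of "cube_mean N (\<lambda>x. g (a + x)) - cube_mean N (\<lambda>x. g (j + x))"
            "cube_mean N (\<lambda>x. g (j + x)) - cube_mean N g"] by simp
    qed
    then show ?thesis using B0 R0 by (intro exI[of _ "2 * B * real CARD('m) * R"]) auto
  qed
  have swap: "cube_mean N (\<lambda>x. cube_mean N' (\<lambda>a. g (x + a))) = cube_mean N' (\<lambda>a. cube_mean N (\<lambda>x. g (a + x)))" for N N'
  proof -
    let ?Q = "cbox (- (N *\<^sub>R One)) (N *\<^sub>R One) :: (real^'m) set"
    let ?Q' = "cbox (- (N' *\<^sub>R One)) (N' *\<^sub>R One) :: (real^'m) set"
    have "integral ?Q (\<lambda>x. integral ?Q' (\<lambda>a. g (x + a))) = integral ?Q' (\<lambda>a. integral ?Q (\<lambda>x. g (x + a)))"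
      by (intro integral_swap_continuous) (unfold split_beta, intro cont' continuous_intros)
    then show ?thesis
      by (simp add: cube_mean_def add.commute)
  qed
  have cont_mean: "continuous_on UNIV (\<lambda>a. cube_mean N (\<lambda>x. g (a + x)))" for N
  proof -
    let ?Q = "cbox (- (N *\<^sub>R One)) (N *\<^sub>R One) :: (real^'m) set"
    have "continuous_on (UNIV \<times> ?Q) (\<lambda>(a, x). g (a + x))"
      unfolding split_beta by (intro cont' continuous_intros)
    from integral_continuous_on_param[OF this] show ?thesis
      unfolding cube_mean_def divide_inverse by (intro continuous_intros)
  qed
  have cauchy: "\<exists>K\<ge>0. \<forall>N>0. \<forall>N'>0. norm (cube_mean N g - cube_mean N' g) \<le> 2 * \<epsilon> + K / N + K / N'"
    if \<epsilon>: "\<epsilon> > 0" for \<epsilon>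
  proof -
    obtain K where K: "K \<ge> 0" "\<And>N a. N > 0 \<Longrightarrow> norm (cube_mean N (\<lambda>x. g (a + x)) - cube_mean N g) \<le> \<epsilon> + K / N"
      using unif[OF \<epsilon>] by blast
    have "norm (cube_mean N g - cube_mean N' g) \<le> 2 * \<epsilon> + K / N + K / N'" if "N > 0" "N' > 0" for N N'
    proof -
      have "norm (cube_mean N' (\<lambda>a. cube_mean N (\<lambda>x. g (a + x))) - cube_mean N g) \<le> \<epsilon> + K / N"
        using that by (intro cube_mean_near cont_mean K)
      moreover have "norm (cube_mean N (\<lambda>x. cube_mean N' (\<lambda>a. g (x + a))) - cube_mean N' g) \<le> \<epsilon> + K / N'"
        using that by (intro cube_mean_near cont_mean K)
      ultimately show ?thesis unfolding swap
        using norm_triangle_ineq4[of "cube_mean N' (\<lambda>a. cube_mean N (\<lambda>x. g (a + x))) - cube_mean N' g"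
            "cube_mean N' (\<lambda>a. cube_mean N (\<lambda>x. g (a + x))) - cube_mean N g"] by simp
    qed
    then show ?thesis using K by blast
  qed
  have "cauchy_filter (filtermap (\<lambda>N. cube_mean N g) at_top)"
    unfolding cauchy_filter_metric_filtermap
  proof (intro allI impI)
    fix e :: real assume e: "e > 0"
    then obtain K where K: "K \<ge> 0" "\<And>N N'. N > 0 \<Longrightarrow> N' > 0 \<Longrightarrow>
        norm (cube_mean N g - cube_mean N' g) \<le> 2 * (e / 5) + K / N + K / N'"
      using cauchy[of "e / 5"] by auto
    define P where "P = (\<lambda>N::real. N > 0 \<and> K / N < e / 5)"
    have "((\<lambda>N. K / N) \<longlongrightarrow> 0) at_top" by real_asymp
    then have "eventually (\<lambda>N. K / N < e / 5) at_top" by (rule order_tendstoD) (use e in auto)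
    then have "eventually P at_top" unfolding P_def
      by (intro eventually_conj eventually_gt_at_top)
    moreover have "dist (cube_mean x g) (cube_mean y g) < e" if "P x \<and> P y" for x y
      using K(2)[of x y] that e unfolding P_def dist_norm by linarith
    ultimately show "\<exists>P. eventually P at_top \<and> (\<forall>x y. P x \<and> P y \<longrightarrow> dist (cube_mean x g) (cube_mean y g) < e)"
      by blast
  qed
  then have "\<exists>L. filtermap (\<lambda>N. cube_mean N g) at_top \<le> nhds L"
    by (rule cauchy_filter_complete_converges) (auto simp: complete_UNIV filtermap_bot_iff)
  then show ?thesis using that by (auto simp: filterlim_def)
qed

text \<open>No common almost period of \<open>f\<close> and the character is sought. Translation by
  \<open>a\<close> acts on \<open>f\<close> nearly like translation by a point \<open>c a\<close> of
  a fixed cube, and on the character as multiplication by the unimodular number \<open>e a\<close>.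
  The pairs \<open>(c a, e a)\<close> form a bounded set in a finite-dimensional space, so finitely
  many translations suffice.\<close>

lemma almost_periodic_modulation_net:
  fixes f :: "real^'m \<Rightarrow> complex" and lam :: "real^'m"
  assumes lip: "\<And>x y. norm (f x - f y) \<le> K * norm (x - y)" and M: "\<And>x. norm (f x) \<le> M"
    and ap: "\<And>\<epsilon>. \<epsilon> > 0 \<Longrightarrow> \<exists>l>0. \<forall>a. \<exists>\<tau>\<in>cube a l. \<forall>x. norm (f (x + \<tau>) - f x) \<le> \<epsilon>"
    and \<epsilon>: "\<epsilon> > 0"
  defines "g \<equiv> \<lambda>x. f x * cis (- (x \<bullet> lam))"
  shows "\<exists>R. \<forall>a. \<exists>j. norm j \<le> R \<and> (\<forall>x. norm (g (a + x) - g (j + x)) \<le> \<epsilon>)"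
proof -
  have M0: "M \<ge> 0" using M[of 0] norm_ge_zero order_trans by blast
  have K0: "K \<ge> 0" using order_trans[OF norm_ge_zero lip[of One 0]]
    by (metis diff_zero mult_less_0_iff not_le norm_le_zero_iff One_nth zero_index zero_neq_one)
  obtain l where l: "l > 0" "\<And>a. \<exists>\<tau>\<in>cube a l. \<forall>x. norm (f (x + \<tau>) - f x) \<le> \<epsilon> / 4"
    using ap[of "\<epsilon> / 4"] \<epsilon> by auto
  have "\<exists>c. c \<in> cbox 0 (l *\<^sub>R One) \<and> (\<forall>x. norm (f (a + x) - f (c + x)) \<le> \<epsilon> / 4)" for a :: "real^'m"
  proof -
    \<comment> \<open>The corner \<open>a - l *\<^sub>R One\<close> is chosen so that the remainder
      \<open>a - \<tau>\<close> falls into the fixed cube at the origin.\<close>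
    obtain \<tau> where \<tau>: "\<tau> \<in> cube (a - l *\<^sub>R One) l" "\<And>x. norm (f (x + \<tau>) - f x) \<le> \<epsilon> / 4"
      using l(2) by blast
    have "a - \<tau> \<in> cbox 0 (l *\<^sub>R One)"
      using \<tau>(1) by (simp add: cube_def mem_box_cart algebra_simps)
    moreover have "norm (f (a + x) - f ((a - \<tau>) + x)) \<le> \<epsilon> / 4" for x
      using \<tau>(2)[of "a - \<tau> + x"] by (simp add: algebra_simps)
    ultimately show ?thesis by blast
  qed
  then obtain c where c: "\<And>a. c a \<in> cbox 0 (l *\<^sub>R One)" "\<And>a x. norm (f (a + x) - f (c a + x)) \<le> \<epsilon> / 4"
    by metis
  define e where "e = (\<lambda>a::real^'m. cis (- (a \<bullet> lam)))"
  \<comment> \<open>Two almost-period errors of \<open>\<epsilon> / 4\<close> leave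
    \<open>\<epsilon> / 2\<close> for the Lipschitz error \<open>K * \<delta>\<close> and the
    character error \<open>M * \<delta>\<close>; the summand 1 keeps the denominator
    positive.\<close>
  define \<delta> where "\<delta> = \<epsilon> / (2 * (K + M + 1))"
  have \<delta>: "\<delta> > 0" "(K + M) * \<delta> \<le> \<epsilon> / 2"
    using \<epsilon> K0 M0 by (auto simp: \<delta>_def field_simps)
  let ?p = "\<lambda>a. (c a, e a)"
  have "bounded (range ?p)"
  proof (rule bounded_subset)
    show "bounded (cbox 0 (l *\<^sub>R One) \<times> cball (0::complex) 1)" by (intro bounded_Times) auto
    show "range ?p \<subseteq> cbox 0 (l *\<^sub>R One) \<times> cball 0 1" using c(1) by (auto simp: e_def)
  qed
  then have compact: "compact (closure (range ?p))" by (simp add: compact_closure)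
  have cover: "closure (range ?p) \<subseteq> (\<Union>a\<in>UNIV. ball (?p a) \<delta>)"
  proof
    fix q assume "q \<in> closure (range ?p)"
    then obtain a where "dist (?p a) q < \<delta>" using \<delta>(1) unfolding closure_approachable by blast
    then show "q \<in> (\<Union>a\<in>UNIV. ball (?p a) \<delta>)" by auto
  qed
  obtain A where A: "A \<subseteq> UNIV" "finite A" "closure (range ?p) \<subseteq> (\<Union>a\<in>A. ball (?p a) \<delta>)"
    by (rule compactE_image[OF compact _ cover]) (rule open_ball)
  obtain R where R: "\<And>j. j \<in> A \<Longrightarrow> norm j \<le> R"
    using finite_imp_bounded[OF A(2)] by (auto simp: bounded_iff)
  have "\<exists>j. norm j \<le> R \<and> (\<forall>x. norm (g (a + x) - g (j + x)) \<le> \<epsilon>)" for a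
  proof -
    have "?p a \<in> range ?p" by (rule rangeI)
    then have "?p a \<in> closure (range ?p)" by (rule subsetD[OF closure_subset])
    then have "?p a \<in> (\<Union>a\<in>A. ball (?p a) \<delta>)" by (rule subsetD[OF A(3)])
    then obtain j where j: "j \<in> A" "dist (?p j) (?p a) < \<delta>" unfolding UN_iff mem_ball by blast
    have cd: "norm (c a - c j) \<le> \<delta>"
      using dist_fst_le[of "?p j" "?p a"] j(2) by (simp add: dist_norm norm_minus_commute)
    have ed: "norm (e a - e j) \<le> \<delta>"
      using dist_snd_le[of "?p j" "?p a"] j(2) by (simp add: dist_norm norm_minus_commute)
    have "norm (g (a + x) - g (j + x)) \<le> \<epsilon>" for x
    proof -
      have split: "g (b + x) = e x * (f (b + x) * e b)" for b
        by (simp add: g_def e_def inner_add_left cis_mult algebra_simps)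
      have "norm (g (a + x) - g (j + x)) = norm (f (a + x) * e a - f (j + x) * e j)"
        unfolding split right_diff_distrib[symmetric] norm_mult by (simp add: e_def)
      also have "f (a + x) * e a - f (j + x) * e j = (f (a + x) - f (j + x)) * e a + f (j + x) * (e a - e j)"
        by (simp add: algebra_simps)
      also have "norm \<dots> \<le> norm (f (a + x) - f (j + x)) + norm (f (j + x)) * norm (e a - e j)"
        by (rule order_trans[OF norm_triangle_ineq]) (simp add: norm_mult e_def)
      also have "norm (f (j + x)) * norm (e a - e j) \<le> M * \<delta>"
        using M ed M0 by (intro mult_mono) auto
      also have "norm (f (a + x) - f (j + x)) \<le> \<epsilon> / 4 + K * \<delta> + \<epsilon> / 4"
      proof -
        have "norm (f (c a + x) - f (c j + x)) \<le> K * norm (c a - c j)"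
          using lip[of "c a + x" "c j + x"] by simp
        also have "\<dots> \<le> K * \<delta>" using cd K0 by (rule mult_left_mono)
        finally show ?thesis
          using c(2)[of a x] c(2)[of j x]
            norm_triangle_ineq[of "f (a + x) - f (c a + x)" "f (c a + x) - f (c j + x)"]
            norm_triangle_ineq4[of "f (a + x) - f (c j + x)" "f (j + x) - f (c j + x)"]
          by simp
      qed
      finally show ?thesis using \<delta>(2) by (simp add: algebra_simps)
    qed
    then show ?thesis using R j by blast
  qed
  then show ?thesis by blast
qed

subsection \<open>Imaginary shifts and Stepanoff almost periodicity\<close>

lemma norm_deriv_le_of_real_increments:
  fixes f :: "complex \<Rightarrow> complex"
  assumes d: "(f has_field_derivative D) (at w)"
    and le: "\<And>h::real. norm (f (w + of_real h) - f w) \<le> K * \<bar>h\<bar>"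
  shows "norm D \<le> K"
proof -
  have "((\<lambda>h. (f (w + h) - f w) / h) \<longlongrightarrow> D) (at 0)"
    using d by (simp add: DERIV_def)
  moreover have "filterlim (\<lambda>h::real. of_real h :: complex) (at 0) (at_right 0)"
    unfolding filterlim_at by (auto intro!: tendsto_eq_intros simp: eventually_at_filter)
  ultimately have "((\<lambda>h::real. (f (w + of_real h) - f w) / of_real h) \<longlongrightarrow> D) (at_right 0)"
    by (rule filterlim_compose[where g = "\<lambda>h. (f (w + h) - f w) / h"])
  then have "((\<lambda>h::real. norm ((f (w + of_real h) - f w) / of_real h)) \<longlongrightarrow> norm D) (at_right 0)"
    by (rule tendsto_norm)
  then show ?thesis
  proof (rule tendsto_upperbound)
    have "norm ((f (w + of_real h) - f w) / of_real h) \<le> K" if "h > 0" for h :: real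
      using le[of h] that by (simp add: norm_divide field_simps)
    then show "eventually (\<lambda>h. norm ((f (w + of_real h) - f w) / of_real h) \<le> K) (at_right (0::real))"
      by (auto simp: eventually_at_filter)
  qed simp
qed

text \<open>Shifting the cube changes the mean by \<open>O(1/N)\<close>, so the mean has an \<open>O(1/N)\<close> derivative
  in the real direction; being holomorphic, it has the same derivative in the imaginary direction.\<close>

lemma cube_mean_imaginary_shift:
  fixes H :: "complex^'m \<Rightarrow> complex"
  assumes H: "exp_type b H" and b: "b \<ge> 0" and M: "\<And>x. norm (H (cvec x)) \<le> M" and N: "N > 0"
  shows "norm (cube_mean N (\<lambda>x. H (cvec x + \<i> *s cvec y)) - cube_mean N (\<lambda>x. H (cvec x)))
          \<le> 2 * (M * exp (b * norm y)) * real CARD('m) * norm y / N"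
proof -
  define B where "B = M * exp (b * norm y)"
  define K where "K = 2 * B * real CARD('m) * norm y / N"
  have M0: "M \<ge> 0" using M[of 0] norm_ge_zero order_trans by blast
  define A where "A = (\<lambda>w. cube_mean N (\<lambda>x. H (cvec x + w *s cvec y)))"
  have contH: "continuous_on S (\<lambda>x. H (f x))" if "continuous_on S f" for S and f :: "'b::topological_space \<Rightarrow> _"
    using that by (rule exp_type_continuous[OF H])
  have "A holomorphic_on UNIV"
    unfolding A_def cube_mean_def divide_inverse
  proof (intro holomorphic_intros holomorphic_integral_cbox)
    show "continuous_on UNIV (\<lambda>(w, x). H (cvec x + w *s cvec y))"
      unfolding split_beta by (intro contH continuous_intros)
  qed (rule exp_type_holomorphic[OF H])
  then have dA: "(A has_field_derivative deriv A w) (at w)" for w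
    by (auto intro: holomorphic_derivI)
  have "norm (A \<i> - A 0) \<le> K * norm (\<i> - 0)"
  proof (rule field_differentiable_bound[where S = "closed_segment 0 \<i>" and f' = "deriv A"])
    fix w assume "w \<in> closed_segment 0 \<i>"
    then have w: "0 \<le> Im w" "Im w \<le> 1" by (auto simp: in_segment)
    have "norm (H (cvec x + w *s cvec y)) \<le> B" for x
    proof -
      have "b * norm y * \<bar>Im w\<bar> \<le> b * norm y"
        using w b by (intro mult_left_le) auto
      then have le: "M * exp (b * norm y * \<bar>Im w\<bar>) \<le> B"
        unfolding B_def using M0 by (intro mult_left_mono) auto
      have "norm (H (cvec x + w *s cvec y)) \<le> M * exp (b * norm y * \<bar>Im w\<bar>)"
        by (rule exp_type_line_bound[OF H b M])
      also note le
      finally show ?thesis .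
    qed
    \<comment> \<open>A real increment \<open>h\<close> of \<open>w\<close> replaces
      \<open>x\<close> by \<open>x + h *\<^sub>R y\<close>, so it is a real translation of the
      averaged function.\<close>
    then have *: "norm (A (w + of_real h) - A w) \<le> 2 * B * real CARD('m) * (norm y * \<bar>h\<bar>) / N" for h
      using cube_mean_shift[where g = "\<lambda>x. H (cvec x + w *s cvec y)" and v = "h *\<^sub>R y" and s = "norm y * \<bar>h\<bar>" and B = B and N = N] N
      by (simp add: A_def cvec_add cvec_scaleR add_ac vector_sadd_rdistrib contH continuous_intros)
    show "norm (deriv A w) \<le> K"
      by (rule norm_deriv_le_of_real_increments[OF dA]) (use * in \<open>simp add: K_def mult.assoc\<close>)
  qed (auto intro: has_field_derivative_at_within dA)
  then show ?thesis by (simp add: A_def K_def B_def)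
qed

section \<open>Modulations, differences of translates and entire functions as functions of
  exponential type\<close>

lemma norm_cpair_le: "norm (cpair z lam) \<le> norm z * norm lam"
proof -
  have "norm (cpair z lam) \<le> (\<Sum>i\<in>UNIV. norm (z $ i * complex_of_real (lam $ i)))"
    unfolding cpair_def by (rule norm_sum)
  also have "\<dots> = (\<Sum>i\<in>UNIV. \<bar>norm (z $ i)\<bar> * \<bar>lam $ i\<bar>)" by (simp add: norm_mult)
  also have "\<dots> \<le> L2_set (\<lambda>i. norm (z $ i)) UNIV * L2_set (\<lambda>i. lam $ i) UNIV"
    by (rule L2_set_mult_ineq)
  finally show ?thesis by (simp add: norm_vec_def L2_set_def)
qed

lemma cpair_add: "cpair (z + w) lam = cpair z lam + cpair w lam"
  by (simp add: cpair_def algebra_simps sum.distrib)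

lemma cpair_smult: "cpair (c *s z) lam = c * cpair z lam"
  by (simp add: cpair_def mult.assoc sum_distrib_left)

lemma cpair_cvec: "cpair (cvec x) lam = of_real (x \<bullet> lam)"
  by (simp add: cpair_def cvec_def inner_vec_def)

lemma exp_type_modulate:
  assumes H: "exp_type b H"
  shows "exp_type (b + norm lam) (\<lambda>z. H z * exp (- \<i> * cpair z lam))"
  unfolding exp_type_def
proof (intro conjI allI)
  show "continuous_on UNIV (\<lambda>z. H z * exp (- \<i> * cpair z lam))"
    unfolding cpair_def by (intro continuous_intros exp_type_continuous[OF H])
  show "(\<lambda>w. H (z + w *s v) * exp (- \<i> * cpair (z + w *s v) lam)) holomorphic_on UNIV" for z v
    unfolding cpair_add cpair_smult by (intro holomorphic_intros exp_type_holomorphic[OF H])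
  obtain C where C: "C \<ge> 0" "\<And>z. norm (H z) \<le> C * exp (b * norm z)"
    using exp_type_growth[OF H] by blast
  show "\<exists>C. \<forall>z. norm (H z * exp (- \<i> * cpair z lam)) \<le> C * exp ((b + norm lam) * norm z)"
  proof (intro exI allI)
    fix z
    have "Re (- \<i> * cpair z lam) \<le> norm z * norm lam"
      using norm_cpair_le[of z lam] abs_Im_le_cmod[of "cpair z lam"] by simp
    then have "norm (exp (- \<i> * cpair z lam)) \<le> exp (norm z * norm lam)"
      unfolding norm_exp_eq_Re by simp
    then have "norm (H z * exp (- \<i> * cpair z lam)) \<le> C * exp (b * norm z) * exp (norm z * norm lam)"
      unfolding norm_mult using C by (intro mult_mono) auto
    then show "norm (H z * exp (- \<i> * cpair z lam)) \<le> C * exp ((b + norm lam) * norm z)"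
      by (simp add: mult.assoc exp_add[symmetric] algebra_simps)
  qed
qed

lemma exp_type_translate_diff:
  assumes H: "exp_type b H" and b: "b \<ge> 0"
  shows "exp_type b (\<lambda>z. H (z + c) - H z)"
  unfolding exp_type_def
proof (intro conjI allI)
  show "continuous_on UNIV (\<lambda>z. H (z + c) - H z)"
    by (intro continuous_intros exp_type_continuous[OF H])
  show "(\<lambda>w. H (z + w *s v + c) - H (z + w *s v)) holomorphic_on UNIV" for z v
    using exp_type_holomorphic[OF H, of "z + c" v] exp_type_holomorphic[OF H, of z v]
    by (intro holomorphic_intros) (simp_all add: add_ac)
  obtain C where C: "C \<ge> 0" "\<And>z. norm (H z) \<le> C * exp (b * norm z)"
    using exp_type_growth[OF H] by blast
  show "\<exists>C. \<forall>z. norm (H (z + c) - H z) \<le> C * exp (b * norm z)"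
  proof (intro exI allI)
    fix z
    have "b * norm (z + c) \<le> b * (norm z + norm c)"
      using b by (intro mult_left_mono norm_triangle_ineq)
    then have "exp (b * norm (z + c)) \<le> exp (b * norm c) * exp (b * norm z)"
      by (simp add: exp_add[symmetric] algebra_simps)
    then have "C * exp (b * norm (z + c)) \<le> C * (exp (b * norm c) * exp (b * norm z))"
      using C by (intro mult_left_mono) auto
    then show "norm (H (z + c) - H z) \<le> (C * exp (b * norm c) + C) * exp (b * norm z)"
      using C(2)[of z] C(2)[of "z + c"] norm_triangle_ineq4[of "H (z + c)" "H z"]
      by (simp add: algebra_simps)
  qed
qed

text \<open>Complex homogeneity of the derivative \<open>L\<close> turns the real chain rule on a
  line into a complex derivative. The type is raised to \<open>max b 0\<close> because the later
  estimates use monotonicity in the norm.\<close>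

lemma entire_m_imp_exp_type:
  fixes F :: "complex^'m \<Rightarrow> complex"
  assumes F: "entire_m F" and growth: "\<And>z. norm (F z) \<le> C * exp (b * norm z)"
  shows "exp_type (max b 0) F"
  unfolding exp_type_def
proof (intro conjI allI)
  show "continuous_on UNIV F"
    using F unfolding entire_m_def continuous_on_eq_continuous_at[OF open_UNIV]
    by (metis has_derivative_continuous)
  show "(\<lambda>w. F (z + w *s v)) holomorphic_on UNIV" for z v
  proof (rule holomorphic_onI)
    fix w :: complex
    obtain L where L: "(F has_derivative L) (at (z + w *s v))" "\<And>c v. L (c *s v) = c * L v"
      using F unfolding entire_m_def by blast
    have "((\<lambda>w. z + w *s v) has_derivative (\<lambda>h. h *s v)) (at w)"
    proof -
      have "bounded_linear (\<lambda>h::complex. h *s v)"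
        by (intro bounded_linear_intro[where K = "norm v"])
          (auto simp: vec_eq_iff algebra_simps norm_vector_smult)
      then show ?thesis by (auto intro!: derivative_eq_intros bounded_linear_imp_has_derivative)
    qed
    from has_derivative_compose[OF this L(1)]
    have "((\<lambda>w. F (z + w *s v)) has_derivative (\<lambda>h. h * L v)) (at w)"
      by (simp add: L(2))
    then have "((\<lambda>w. F (z + w *s v)) has_field_derivative L v) (at w)"
      by (simp only: has_field_derivative_def mult_commute_abs)
    then show "(\<lambda>w. F (z + w *s v)) field_differentiable at w within UNIV"
      by (auto simp: field_differentiable_def)
  qed
  have C0: "C \<ge> 0" using order_trans[OF norm_ge_zero growth[of 0]] by simp
  show "\<exists>C. \<forall>z. norm (F z) \<le> C * exp (max b 0 * norm z)"
  proof (intro exI allI)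
    fix z :: "complex^'m"
    have "C * exp (b * norm z) \<le> C * exp (max b 0 * norm z)"
      using C0 by (intro mult_left_mono) (auto intro: mult_right_mono)
    then show "norm (F z) \<le> C * exp (max b 0 * norm z)" using growth[of z] by linarith
  qed
qed

section \<open>From Stepanoff means to translations on tubes\<close>

lemma integral_unit_cube_le_of_powr_mean:
  fixes g :: "real^'m \<Rightarrow> real"
  assumes cont: "continuous_on (cbox 0 One) g" and g0: "\<And>x. g x \<ge> 0" and p: "p \<ge> 1" and \<mu>: "\<mu> > 0"
    and le: "integral (cbox 0 One) (\<lambda>x. g x powr p) powr (1 / p) \<le> \<mu>"
  shows "integral (cbox 0 One) g \<le> 2 * \<mu>"
proof -
  define I where "I = integral (cbox 0 One) (\<lambda>x. g x powr p)"
  have vol: "measure lborel (cbox 0 (One :: real^'m)) = 1"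
    using content_cube[of 0 1, where 'm = 'm] by simp
  have contp: "continuous_on (cbox 0 One) (\<lambda>x. g x powr p)"
    using p g0 by (intro continuous_on_powr' cont continuous_intros) auto
  have I0: "I \<ge> 0" unfolding I_def by (rule integral_nonneg[OF integrable_continuous[OF contp]]) simp
  have "I = (I powr (1 / p)) powr p" using I0 p by (simp add: powr_powr)
  also have "\<dots> \<le> \<mu> powr p" using le p unfolding I_def by (intro powr_mono2) auto
  finally have I: "I \<le> \<mu> powr p" .
  \<comment> \<open>Pointwise substitute for Hoelder's inequality: above the level \<mu> the factor
    \<open>g x powr (1 - p)\<close> is at most \<open>\<mu> powr (1 - p)\<close>, as
    \<open>1 - p\<close> is nonpositive. The price is the factor 2 in the conclusion.\<close>
  have pt: "g x \<le> \<mu> + \<mu> powr (1 - p) * g x powr p" for x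
  proof (cases "g x \<le> \<mu>")
    case True
    then show ?thesis by (simp add: add_increasing2)
  next
    case False
    then have gx: "g x > \<mu>" by simp
    have "g x = g x powr (1 - p) * g x powr p"
      using gx \<mu> by (simp add: powr_add[symmetric])
    also have "\<dots> \<le> \<mu> powr (1 - p) * g x powr p"
      using gx \<mu> p by (intro mult_right_mono powr_mono2') auto
    finally show ?thesis using \<mu> by simp
  qed
  have "integral (cbox 0 One) g \<le> integral (cbox 0 One) (\<lambda>x. \<mu> + \<mu> powr (1 - p) * g x powr p)"
    using pt by (intro integral_le integrable_continuous continuous_intros cont contp)
  also have "\<dots> = \<mu> + \<mu> powr (1 - p) * I"
    unfolding I_def
    by (subst integral_add) (auto simp: vol intro!: integrable_continuous continuous_intros contp)
  also have "\<mu> powr (1 - p) * I \<le> \<mu> powr (1 - p) * \<mu> powr p" using I by (intro mult_left_mono) auto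
  also have "\<dots> = \<mu>" using \<mu> by (simp add: powr_add[symmetric])
  finally show ?thesis by simp
qed

lemma cvec_Re_Im: "z = cvec (\<chi> i. Re (z $ i)) + \<i> *s cvec (imv z)"
  by (simp add: vec_eq_iff cvec_def imv_def complex_eq_iff)

lemma norm_le_norm_cvec_add_imaginary: "norm y \<le> norm (cvec x + \<i> *s cvec y)"
  unfolding norm_vec_def
proof (rule L2_set_mono)
  show "norm (y $ i) \<le> norm ((cvec x + \<i> *s cvec y) $ i)" for i
    using abs_Im_le_cmod[of "of_real (x $ i) + \<i> * of_real (y $ i)"] by (simp add: cvec_def)
qed simp

lemma stepanoff_translate_integral_le:
  assumes H: "exp_type b H" and p: "p \<ge> 1" and \<epsilon>: "\<epsilon> > 0"
    and le: "integral (cbox 0 One)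
        (\<lambda>u. norm (H (cvec (x + u + \<tau>)) - H (cvec (x + u))) powr p) powr (1 / p) \<le> \<epsilon>"
  shows "integral (cbox 0 One) (\<lambda>u. norm (H (cvec (x + u + \<tau>)) - H (cvec (x + u)))) \<le> 2 * \<epsilon>"
  by (rule integral_unit_cube_le_of_powr_mean[OF _ _ p \<epsilon> le])
    (intro continuous_intros exp_type_continuous[OF H], simp)

text \<open>An almost period from the cube at \<open>- x\<close> moves the unit cube at
  \<open>x\<close> into a fixed cube of side \<open>l + 1\<close>, on which \<open>H\<close> is
  bounded by compactness. Accuracy 1 is enough, and passing from the \<open>p\<close>-th power mean
  to the mean doubles it.\<close>

lemma stepanoff_ap_imp_local_mean_bounded:
  fixes H :: "complex^'m \<Rightarrow> complex"
  assumes H: "exp_type b H" and p: "p \<ge> 1" and ap: "stepanoff_ap p (\<lambda>x. H (cvec x))"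
  obtains S where "\<And>x. integral (cbox 0 One) (\<lambda>u. norm (H (cvec (x + u)))) \<le> S"
proof -
  obtain l where l: "l > 0" "\<And>a. \<exists>\<tau>\<in>cube a l. \<exists>M<1. \<forall>x. (integral (cbox 0 One)
       (\<lambda>u. norm (H (cvec (x + u + \<tau>)) - H (cvec (x + u))) powr p)) powr (1 / p) \<le> M"
    using ap unfolding stepanoff_ap_def by (meson zero_less_one)
  have cont: "continuous_on A (\<lambda>u. H (cvec (f u)))" if "continuous_on A f" for A and f :: "_ \<Rightarrow> real^'m"
    using that by (intro exp_type_continuous[OF H] continuous_intros)
  have "compact ((\<lambda>x. H (cvec x)) ` cbox 0 ((l + 1) *\<^sub>R One))"
    by (intro compact_continuous_image cont continuous_intros compact_cbox)
  then obtain M1 where M1: "\<And>x. x \<in> cbox 0 ((l + 1) *\<^sub>R One) \<Longrightarrow> norm (H (cvec x)) \<le> M1"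
    using compact_imp_bounded by (fastforce simp: bounded_iff)
  have "integral (cbox 0 One) (\<lambda>u. norm (H (cvec (x + u)))) \<le> M1 + 2" for x
  proof -
    obtain \<tau> M where \<tau>: "\<tau> \<in> cube (- x) l" "M < 1" "\<And>x. (integral (cbox 0 One)
       (\<lambda>u. norm (H (cvec (x + u + \<tau>)) - H (cvec (x + u))) powr p)) powr (1 / p) \<le> M"
      using l(2) by meson
    have "integral (cbox 0 One) (\<lambda>u. norm (H (cvec (x + u)))) \<le>
          integral (cbox 0 One) (\<lambda>u. M1 + norm (H (cvec (x + u + \<tau>)) - H (cvec (x + u))))"
    proof (intro integral_le integrable_continuous continuous_intros cont)
      fix u :: "real^'m" assume u: "u \<in> cbox 0 One"
      have "x + u + \<tau> \<in> cbox 0 ((l + 1) *\<^sub>R One)"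
        unfolding mem_box_cart
      proof
        fix i
        have "- (x $ i) \<le> \<tau> $ i" "\<tau> $ i \<le> - (x $ i) + l" "0 \<le> u $ i" "u $ i \<le> 1"
          using u \<tau>(1) by (auto simp: mem_box_cart cube_def)
        then show "0 $ i \<le> (x + u + \<tau>) $ i \<and> (x + u + \<tau>) $ i \<le> ((l + 1) *\<^sub>R One) $ i" by simp
      qed
      then show "norm (H (cvec (x + u))) \<le> M1 + norm (H (cvec (x + u + \<tau>)) - H (cvec (x + u)))"
        using M1 norm_triangle_ineq4[of "H (cvec (x + u + \<tau>))" "H (cvec (x + u + \<tau>)) - H (cvec (x + u))"]
        by fastforce
    qed
    also have "\<dots> = M1 + integral (cbox 0 One) (\<lambda>u. norm (H (cvec (x + u + \<tau>)) - H (cvec (x + u))))"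
      using content_cube[of 0 1, where 'm = 'm]
      by (subst integral_add) (auto intro!: integrable_continuous continuous_intros cont)
    also have "integral (cbox 0 One) (\<lambda>u. norm (H (cvec (x + u + \<tau>)) - H (cvec (x + u)))) \<le> 2 * 1"
      by (rule stepanoff_translate_integral_le[OF H p]) (use \<tau> in \<open>auto intro: order_trans less_imp_le\<close>)
    finally show ?thesis by simp
  qed
  then show ?thesis using that by blast
qed

lemma exp_type_stepanoff_imp_tube_translation:
  fixes H :: "complex^'m \<Rightarrow> complex"
  assumes H: "exp_type b H" and b: "b \<ge> 0" and p: "p \<ge> 1" and ap: "stepanoff_ap p (\<lambda>x. H (cvec x))"
    and \<epsilon>: "\<epsilon> > 0"
  shows "\<exists>l>0. \<forall>a. \<exists>\<tau>\<in>cube a l. \<forall>x y. norm y \<le> R \<longrightarrow>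
           norm (H (cvec x + \<i> *s cvec y + cvec \<tau>) - H (cvec x + \<i> *s cvec y)) \<le> \<epsilon>"
proof -
  obtain K where K: "K > 0" "\<And>(H :: complex^'m \<Rightarrow> complex) S x. exp_type b H \<Longrightarrow>
      (\<And>x. integral (cbox 0 One) (\<lambda>u. norm (H (cvec (x + u)))) \<le> S) \<Longrightarrow> norm (H (cvec x)) \<le> K * S"
    using exp_type_local_mean_constant[OF b] by blast
  \<comment> \<open>Chosen so that \<open>K * (2 * \<mu>) * exp (b * R) = \<epsilon>\<close>: the 2
    comes from passing to ordinary means, \<open>K\<close> from means to values on the real
    subspace, the exponential from there to the tube.\<close>
  define \<mu> where "\<mu> = \<epsilon> / (2 * K * exp (b * R))"
  have \<mu>: "\<mu> > 0" using \<epsilon> K by (simp add: \<mu>_def)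
  obtain l where l: "l > 0" "\<And>a. \<exists>\<tau>\<in>cube a l. \<exists>M<\<mu>. \<forall>x. (integral (cbox 0 One)
       (\<lambda>u. norm (H (cvec (x + u + \<tau>)) - H (cvec (x + u))) powr p)) powr (1 / p) \<le> M"
    using ap \<mu> unfolding stepanoff_ap_def by meson
  have "\<exists>\<tau>\<in>cube a l. \<forall>x y. norm y \<le> R \<longrightarrow>
           norm (H (cvec x + \<i> *s cvec y + cvec \<tau>) - H (cvec x + \<i> *s cvec y)) \<le> \<epsilon>" for a
  proof -
    obtain \<tau> M where \<tau>: "\<tau> \<in> cube a l" "M < \<mu>" "\<And>x. (integral (cbox 0 One)
       (\<lambda>u. norm (H (cvec (x + u + \<tau>)) - H (cvec (x + u))) powr p)) powr (1 / p) \<le> M"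
      using l(2) by meson
    define G where "G = (\<lambda>z. H (z + cvec \<tau>) - H z)"
    have G: "exp_type b G" unfolding G_def by (rule exp_type_translate_diff[OF H b])
    have real: "norm (G (cvec x)) \<le> K * (2 * \<mu>)" for x
    proof (rule K(2)[OF G])
      fix x :: "real^'m"
      have "integral (cbox 0 One) (\<lambda>u. norm (H (cvec (x + u + \<tau>)) - H (cvec (x + u)))) \<le> 2 * \<mu>"
        by (rule stepanoff_translate_integral_le[OF H p \<mu>])
          (use \<tau> in \<open>auto intro: order_trans less_imp_le\<close>)
      then show "integral (cbox 0 One) (\<lambda>u. norm (G (cvec (x + u)))) \<le> 2 * \<mu>"
        by (simp add: G_def cvec_add)
    qed
    have "norm (G (cvec x + \<i> *s cvec y)) \<le> \<epsilon>" if y: "norm y \<le> R" for x y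
    proof -
      have "norm (G (cvec x + \<i> *s cvec y)) \<le> K * (2 * \<mu>) * exp (b * norm y)"
        by (rule exp_type_tube_bound[OF G b real])
      also have "\<dots> \<le> K * (2 * \<mu>) * exp (b * R)"
        using \<mu> K y b by (intro mult_left_mono) (auto intro: mult_left_mono)
      also have "\<dots> = \<epsilon>" using K by (simp add: \<mu>_def)
      finally show ?thesis .
    qed
    then show ?thesis using \<tau>(1) by (auto simp: G_def)
  qed
  then show ?thesis using l(1) by blast
qed

section \<open>Fourier coefficients on the tube and the spectrum\<close>

lemma fourier_coeff_eq:
  assumes "((\<lambda>N. cube_mean N (\<lambda>x. f x * cis (- (x \<bullet> lam)))) \<longlongrightarrow> L) at_top"
  shows "fourier_coeff f lam = L"
  using assms unfolding fourier_coeff_def cube_mean_def by (intro tendsto_Lim) auto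

text \<open>At height \<open>y\<close> the modulation differs from the real character by the
  positive weight \<open>exp (of_real (y \<bullet> lam))\<close>, the source of the exponential
  factor relating coefficients at different heights.\<close>

lemma modulate_on_tube:
  "F (cvec x + \<i> *s cvec y) * exp (- \<i> * cpair (cvec x + \<i> *s cvec y) lam) =
   F (cvec x + \<i> *s cvec y) * cis (- (x \<bullet> lam)) * exp (of_real (y \<bullet> lam))"
proof -
  have "- \<i> * cpair (cvec x + \<i> *s cvec y) lam = \<i> * of_real (- (x \<bullet> lam)) + of_real (y \<bullet> lam)"
    by (simp add: cpair_add cpair_smult cpair_cvec algebra_simps)
  then show ?thesis by (simp only: exp_add cis_conv_exp mult.assoc)
qed

text \<open>The Dirichlet series is expressed slice by slice: at height \<open>y\<close> the term
  with exponent \<open>lam\<close> of the series in \<open>z\<close> restricts to a Fourier term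
  whose coefficient carries the factor
  \<open>exp (- complex_of_real (y \<bullet> lam))\<close>.\<close>

theorem theorem6:
  fixes F :: "complex^'m \<Rightarrow> complex" and C b p :: real
  assumes "entire_m F"
    and "\<And>z. norm (F z) \<le> C * exp (b * norm z)"
    and "p \<ge> 1"
    and "stepanoff_ap p (\<lambda>x. F (cvec x))"
  shows "(\<forall>D. bounded D \<longrightarrow> bohr_ap_on D F)
    \<and> (\<forall>y lam. fourier_coeff (\<lambda>x. F (cvec x + \<i> *s cvec y)) lam
               = fourier_coeff (\<lambda>x. F (cvec x)) lam * exp (- complex_of_real (y \<bullet> lam)))
    \<and> spectrum_ap (\<lambda>x. F (cvec x)) \<subseteq> cball 0 b"
proof -
  define b' where "b' = max b 0"
  have b': "b' \<ge> 0" by (simp add: b'_def)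
  have F: "exp_type b' F" unfolding b'_def by (rule entire_m_imp_exp_type[OF assms(1,2)])
  have C0: "C \<ge> 0" using order_trans[OF norm_ge_zero assms(2)[of 0]] by simp
  have contF: "continuous_on A (\<lambda>x. F (f x))" if "continuous_on A f" for A and f :: "'x::topological_space \<Rightarrow> _"
    using that by (rule exp_type_continuous[OF F])
  note trans = exp_type_stepanoff_imp_tube_translation[OF F b' assms(3,4)]
  obtain M where M: "\<And>x. norm (F (cvec x)) \<le> M"
  proof -
    obtain S where "\<And>x. integral (cbox 0 One) (\<lambda>u. norm (F (cvec (x + u)))) \<le> S"
      using stepanoff_ap_imp_local_mean_bounded[OF F assms(3,4)] by blast
    then show ?thesis
      using that exp_type_local_mean_constant[OF b'] F by metis
  qed
  have bohr: "bohr_ap_on D F" if "bounded D" for D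
    unfolding bohr_ap_on_def
  proof (intro conjI allI impI)
    show "continuous_on (tube D) F" using contF[of "tube D" "\<lambda>z. z"] by (simp add: continuous_intros)
    obtain R where R: "\<And>y. y \<in> D \<Longrightarrow> norm y \<le> R" using \<open>bounded D\<close> by (auto simp: bounded_iff)
    fix \<epsilon> :: real assume \<epsilon>: "\<epsilon> > 0"
    obtain l where l: "l > 0" "\<And>a. \<exists>\<tau>\<in>cube a l. \<forall>x y. norm y \<le> R \<longrightarrow>
           norm (F (cvec x + \<i> *s cvec y + cvec \<tau>) - F (cvec x + \<i> *s cvec y)) \<le> \<epsilon> / 2"
      using trans[of "\<epsilon> / 2" R] \<epsilon> by (metis half_gt_zero)
    show "\<exists>l>0. \<forall>a. \<exists>\<tau>\<in>cube a l. \<exists>M<\<epsilon>. \<forall>z\<in>tube D. norm (F (z + cvec \<tau>) - F z) \<le> M"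
    proof (intro exI[of _ l] conjI allI)
      fix a :: "real^'m"
      obtain \<tau> where \<tau>: "\<tau> \<in> cube a l" "\<And>x y. norm y \<le> R \<Longrightarrow>
           norm (F (cvec x + \<i> *s cvec y + cvec \<tau>) - F (cvec x + \<i> *s cvec y)) \<le> \<epsilon> / 2"
        using l(2) by meson
      have "norm (F (z + cvec \<tau>) - F z) \<le> \<epsilon> / 2" if "z \<in> tube D" for z
        using \<tau>(2)[of "imv z" "\<chi> i. Re (z $ i)"] R[of "imv z"] that
        by (simp add: tube_def cvec_Re_Im[symmetric])
      then show "\<exists>\<tau>\<in>cube a l. \<exists>M<\<epsilon>. \<forall>z\<in>tube D. norm (F (z + cvec \<tau>) - F z) \<le> M"
        using \<tau>(1) \<epsilon> by (intro bexI[of _ \<tau>] exI[of _ "\<epsilon> / 2"]) auto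
    qed (rule l)
  qed
  have mean: "\<exists>L. ((\<lambda>N. cube_mean N (\<lambda>x. F (cvec x) * cis (- (x \<bullet> lam)))) \<longlongrightarrow> L) at_top" for lam
  proof (rule cube_mean_convergent)
    show "continuous_on UNIV (\<lambda>x. F (cvec x) * cis (- (x \<bullet> lam)))"
      unfolding cis_conv_exp by (intro continuous_intros contF)
    show "norm (F (cvec x) * cis (- (x \<bullet> lam))) \<le> M" for x
      using M by (simp add: norm_mult)
    show "\<exists>R. \<forall>a. \<exists>j. norm j \<le> R \<and> (\<forall>x. norm (F (cvec (a + x)) * cis (- ((a + x) \<bullet> lam)) -
            F (cvec (j + x)) * cis (- ((j + x) \<bullet> lam))) \<le> \<epsilon>)" if \<epsilon>: "\<epsilon> > 0" for \<epsilon>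
    proof (rule almost_periodic_modulation_net[where f = "\<lambda>x. F (cvec x)", OF _ M _ \<epsilon>])
      show "norm (F (cvec x) - F (cvec y)) \<le> (M * exp b') * norm (x - y)" for x y
        using exp_type_lipschitz[OF F b' M, of y "x - y"] by simp
      show "\<exists>l>0. \<forall>a. \<exists>\<tau>\<in>cube a l. \<forall>x. norm (F (cvec (x + \<tau>)) - F (cvec x)) \<le> \<eta>" if \<eta>: "\<eta> > 0" for \<eta>
      proof -
        \<comment> \<open>Radius 0 leaves only \<open>y = 0\<close>, so these are almost periods on
          the real subspace.\<close>
        obtain l where l: "l > 0" "\<And>a. \<exists>\<tau>\<in>cube a l. \<forall>x y. norm y \<le> 0 \<longrightarrow>
           norm (F (cvec x + \<i> *s cvec y + cvec \<tau>) - F (cvec x + \<i> *s cvec y)) \<le> \<eta>"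
          using trans[OF \<eta>, of 0] by blast
        have "\<exists>\<tau>\<in>cube a l. \<forall>x. norm (F (cvec (x + \<tau>)) - F (cvec x)) \<le> \<eta>" for a
          using l(2)[of a] by (fastforce simp: cvec_add)
        then show ?thesis using l(1) by blast
      qed
    qed
  qed blast
  have tube_mean: "((\<lambda>N. cube_mean N (\<lambda>x. F (cvec x + \<i> *s cvec y) * cis (- (x \<bullet> lam)) * exp (of_real (y \<bullet> lam))))
      \<longlongrightarrow> fourier_coeff (\<lambda>x. F (cvec x)) lam) at_top" for y lam
  proof -
    define H where "H = (\<lambda>z. F z * exp (- \<i> * cpair z lam))"
    define \<beta> where "\<beta> = b' + norm lam"
    have H: "exp_type \<beta> H" unfolding H_def \<beta>_def by (rule exp_type_modulate[OF F])
    have \<beta>: "\<beta> \<ge> 0" using b' by (simp add: \<beta>_def)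
    have Hreal: "H (cvec x) = F (cvec x) * cis (- (x \<bullet> lam))" for x
      using modulate_on_tube[of F x 0 lam] by (simp add: H_def)
    have Htube: "H (cvec x + \<i> *s cvec y) = F (cvec x + \<i> *s cvec y) * cis (- (x \<bullet> lam)) * exp (of_real (y \<bullet> lam))" for x
      unfolding H_def by (rule modulate_on_tube)
    have MH: "norm (H (cvec x)) \<le> M" for x using M by (simp add: Hreal norm_mult)
    obtain L where L: "((\<lambda>N. cube_mean N (\<lambda>x. H (cvec x))) \<longlongrightarrow> L) at_top"
      using mean[of lam] unfolding Hreal by blast
    then have coeff: "fourier_coeff (\<lambda>x. F (cvec x)) lam = L"
      unfolding Hreal by (rule fourier_coeff_eq)
    define K where "K = 2 * (M * exp (\<beta> * norm y)) * real CARD('m) * norm y"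
    have "((\<lambda>N. cube_mean N (\<lambda>x. H (cvec x + \<i> *s cvec y)) - cube_mean N (\<lambda>x. H (cvec x))) \<longlongrightarrow> 0) at_top"
    proof (rule Lim_null_comparison)
      show "eventually (\<lambda>N. norm (cube_mean N (\<lambda>x. H (cvec x + \<i> *s cvec y)) - cube_mean N (\<lambda>x. H (cvec x))) \<le> K / N) at_top"
        using eventually_gt_at_top[of 0]
        by eventually_elim (unfold K_def, rule cube_mean_imaginary_shift[OF H \<beta> MH])
      show "((\<lambda>N. K / N) \<longlongrightarrow> 0) at_top" by real_asymp
    qed
    from tendsto_add[OF this L] show ?thesis unfolding Htube coeff by simp
  qed
  have dirichlet: "fourier_coeff (\<lambda>x. F (cvec x + \<i> *s cvec y)) lam
               = fourier_coeff (\<lambda>x. F (cvec x)) lam * exp (- complex_of_real (y \<bullet> lam))" for y lam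
  proof (rule fourier_coeff_eq)
    have "cube_mean N (\<lambda>x. F (cvec x + \<i> *s cvec y) * cis (- (x \<bullet> lam)) * exp (of_real (y \<bullet> lam))) * exp (- complex_of_real (y \<bullet> lam))
      = cube_mean N (\<lambda>x. F (cvec x + \<i> *s cvec y) * cis (- (x \<bullet> lam)))" for N
      by (simp add: cube_mean_def exp_minus)
    with tendsto_mult_right[OF tube_mean[of y lam], of "exp (- complex_of_real (y \<bullet> lam))"]
    show "((\<lambda>N. cube_mean N (\<lambda>x. F (cvec x + \<i> *s cvec y) * cis (- (x \<bullet> lam)))) \<longlongrightarrow>
       fourier_coeff (\<lambda>x. F (cvec x)) lam * exp (- complex_of_real (y \<bullet> lam))) at_top"
      by simp
  qed
  \<comment> \<open>Growth in \<open>y\<close> with the original \<open>b\<close>, uniformly in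
    \<open>x\<close>. For \<open>b \<ge> 0\<close> this is the tube bound with the real supremum;
    for negative \<open>b\<close> it follows directly from the hypothesis, since the imaginary part
    is no longer than the whole vector.\<close>
  obtain C' where C': "C' \<ge> 0" "\<And>x y. norm (F (cvec x + \<i> *s cvec y)) \<le> C' * exp (b * norm y)"
  proof (cases "b \<ge> 0")
    case True
    then have "norm (F (cvec x + \<i> *s cvec y)) \<le> M * exp (b * norm y)" for x y
      using exp_type_tube_bound[OF F b' M] by (simp add: b'_def)
    then show ?thesis using that M[of 0] norm_ge_zero order_trans by blast
  next
    case False
    have "norm (F (cvec x + \<i> *s cvec y)) \<le> C * exp (b * norm y)" for x y
    proof -
      have "b * norm (cvec x + \<i> *s cvec y) \<le> b * norm y"
        using False norm_le_norm_cvec_add_imaginary[of y x] by (intro mult_left_mono_neg) auto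
      then have "C * exp (b * norm (cvec x + \<i> *s cvec y)) \<le> C * exp (b * norm y)"
        using C0 by (intro mult_left_mono) auto
      then show ?thesis using assms(2)[of "cvec x + \<i> *s cvec y"] by linarith
    qed
    then show ?thesis using that C0 by blast
  qed
  have coeff_le: "norm (fourier_coeff (\<lambda>x. F (cvec x)) lam) \<le> C' * exp (b * norm y) * exp (y \<bullet> lam)" for y lam
  proof (rule tendsto_upperbound[OF tendsto_norm[OF tube_mean[of y lam]]])
    have *: "norm (cube_mean N (\<lambda>x. F (cvec x + \<i> *s cvec y) * cis (- (x \<bullet> lam)) * exp (of_real (y \<bullet> lam))))
        \<le> C' * exp (b * norm y) * exp (y \<bullet> lam)" if "N > 0" for N
    proof (rule norm_cube_mean_le[OF that])
      show "continuous_on UNIV (\<lambda>x. F (cvec x + \<i> *s cvec y) * cis (- (x \<bullet> lam)) * exp (of_real (y \<bullet> lam)))"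
        unfolding cis_conv_exp by (intro continuous_intros contF)
      show "norm (F (cvec x + \<i> *s cvec y) * cis (- (x \<bullet> lam)) * exp (of_real (y \<bullet> lam))) \<le> C' * exp (b * norm y) * exp (y \<bullet> lam)" for x
        using C'(2)[of x y] by (simp add: norm_mult norm_exp_eq_Re)
    qed
    show "eventually (\<lambda>N. norm (cube_mean N (\<lambda>x. F (cvec x + \<i> *s cvec y) * cis (- (x \<bullet> lam)) * exp (of_real (y \<bullet> lam))))
        \<le> C' * exp (b * norm y) * exp (y \<bullet> lam)) at_top"
      by (rule eventually_mono[OF eventually_gt_at_top[of 0] *])
  qed simp
  have spectrum: "norm lam \<le> b" if "fourier_coeff (\<lambda>x. F (cvec x)) lam \<noteq> 0" for lam
  proof (rule ccontr)
    assume "\<not> norm lam \<le> b"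
    then have nl: "b - norm lam < 0" by simp
    \<comment> \<open>A unit vector along \<open>lam\<close>. The case \<open>lam = 0\<close> arises
      when \<open>b\<close> is negative, and there any unit vector serves.\<close>
    obtain e :: "real^'m" where e: "norm e = 1" "e \<bullet> lam = norm lam"
    proof (cases "lam = 0")
      case True
      then show ?thesis using that[of "axis undefined 1"] by simp
    next
      case False
      then show ?thesis using that[of "lam /\<^sub>R norm lam"] by (simp add: dot_square_norm power2_eq_square)
    qed
    let ?a = "norm (fourier_coeff (\<lambda>x. F (cvec x)) lam)"
    \<comment> \<open>With \<open>y\<close> equal to \<open>- (t *\<^sub>R e)\<close> the weight
      contributes \<open>exp (- t * norm lam)\<close> against the growth
      \<open>exp (b * t)\<close>.\<close>
    have "?a \<le> C' * exp (t * (b - norm lam))" if "t > 0" for t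
      using coeff_le[of lam "- (t *\<^sub>R e)"] e that by (simp add: mult.assoc exp_add[symmetric] algebra_simps)
    moreover have "((\<lambda>t. C' * exp (t * (b - norm lam))) \<longlongrightarrow> 0) at_top"
      using nl by real_asymp
    ultimately have "?a \<le> 0"
      by (intro tendsto_lowerbound[of "\<lambda>t. C' * exp (t * (b - norm lam))" 0 at_top])
        (auto intro: eventually_mono[OF eventually_gt_at_top[of 0]])
    then show False using that by simp
  qed
  show ?thesis using bohr dirichlet spectrum by (auto simp: spectrum_ap_def)
qed

end
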